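(* For a nonnegative integer $n$, let $Q_5(n)$ be the number of partitions of $n$ into distinct parts congruent to $\pm 1,\pm 5,\pm 7,\pm 9 \pmod{24}$; let $Q_{11}(n)$ be the number of partitions of $n$ into distinct parts congruent to $\pm 1,\pm 7,\pm 9,\pm 11 \pmod{24}$; let $\mathfrak{Q}_7(n)$ be the number of partitions of $n$ into distinct parts congruent to $\pm 1,\pm 7,\pm 9,\pm 11 \pmod{30}$; and let $\mathfrak{Q}_{13}(n)$ be the number of partitions of $n$ into distinct parts congruent to $\pm 1,\pm 9,\pm 11,\pm 13 \pmod{30}$. Then $Q_5(n-1)=Q_{11}(n)$ and $\mathfrak{Q}_7(n-1)=\mathfrak{Q}_{13}(n)$ for all positive integers $n\equiv 4 \pmod 6$. Moreover, there are infinitely many positive integers $n\equiv 0$ or $2 \pmod 6$ with $Q_5(n-1)\neq Q_{11}(n)$, and infinitely many positive integers $m\equiv 0$ or $2\pmod 6$ with $\mathfrak{Q}_7(m-1)\neq \mathfrak{Q}_{13}(m)$.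
   Context: A partition of $n$ is a non-increasing sequence of positive integers summing to $n$; the empty partition is the unique partition of $0$. *)

theory Defs
  imports Main "HOL-Number_Theory.Cong"
begin

definition is_partition :: "nat \<Rightarrow> nat list \<Rightarrow> bool" where
  "is_partition n ps \<longleftrightarrow> sorted_wrt (\<ge>) ps \<and> (\<forall>p\<in>set ps. 0 < p) \<and> sum_list ps = n"

definition cong_pm :: "nat \<Rightarrow> int set \<Rightarrow> nat \<Rightarrow> bool" where
  "cong_pm m R p \<longleftrightarrow> (\<exists>r\<in>R. [int p = r] (mod int m) \<or> [int p = - r] (mod int m))"

definition distinct_partitions :: "nat \<Rightarrow> int set \<Rightarrow> nat \<Rightarrow> nat list set" where
  "distinct_partitions m R n =
     {ps. is_partition n ps \<and> distinct ps \<and> (\<forall>p\<in>set ps. cong_pm m R p)}"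

lemma finite_distinct_partitions: "finite (distinct_partitions m R n)"
proof (rule finite_subset)
  have len: "length ps \<le> sum_list ps" if "\<forall>p\<in>set ps. 0 < p" for ps :: "nat list"
    using that by (induction ps) auto
  show "distinct_partitions m R n \<subseteq> {ps. set ps \<subseteq> {..n} \<and> length ps \<le> n}"
    using len by (auto simp: distinct_partitions_def is_partition_def member_le_sum_list)
  show "finite {ps. set ps \<subseteq> {..n} \<and> length ps \<le> n}"
    by (rule finite_lists_length_le) simp
qed

definition Q5 :: "nat \<Rightarrow> nat" where
  "Q5 n = card (distinct_partitions 24 {1, 5, 7, 9} n)"

definition Q11 :: "nat \<Rightarrow> nat" where
  "Q11 n = card (distinct_partitions 24 {1, 7, 9, 11} n)"

definition frakQ7 :: "nat \<Rightarrow> nat" where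
  "frakQ7 n = card (distinct_partitions 30 {1, 7, 9, 11} n)"

definition frakQ13 :: "nat \<Rightarrow> nat" where
  "frakQ13 n = card (distinct_partitions 30 {1, 9, 11, 13} n)"

end

theory Submission
  imports Defs "HOL-Computational_Algebra.Formal_Power_Series"
begin

text \<open>Write \<open>F(a, b; s)\<close> for \<open>\<Prod> (1 + q\<^sup>p)\<close> over \<open>p \<equiv> a, b (mod s)\<close>, and take \<open>s = 2h\<close> with
  \<open>h = 4\<close> (modulus 24) or \<open>h = 5\<close> (modulus 30). In either case the two generating functions share
  the factor \<open>F(1, s - 1; s)\<close>, so their difference (the second one shifted by \<open>q\<close>) is
  \<open>D = F(1, s - 1; s) \<cdot> (F(2h + 3, 4h - 3; 3s) - q F(2h - 3, 4h + 3; 3s))\<close>. By the Jacobi triple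
  product all factors become theta series, and a quintuple product identity gives
  \<open>D \<cdot> \<Prod> (1 - q\<^bsup>3sn\<^esup>) = \<Sum>\<^bsub>j\<^esub> (-1)\<^sup>j q\<^bsup>h j(j-1) + 2j\<^esup>\<close>. These exponents are never
  \<open>1\<close> modulo \<open>3\<close>, and \<open>3s\<close> is a multiple of \<open>6\<close>, so the coefficients of \<open>D\<close> at
  \<open>n \<equiv> 4 (mod 6)\<close> vanish. For \<open>h = 4\<close> the coefficients at \<open>24k + 2\<close> are negative since only
  odd \<open>j\<close> contribute; for \<open>h = 5\<close> those at \<open>30k\<close> are positive since the
  subseries \<open>15 | j\<close> is again a triple product, dividing \<open>\<Prod> (1 - q\<^bsup>30n\<^esup>)\<close>.\<close>

section \<open>Infinite products of power series\<close>

text \<open>Congruence modulo \<open>X^(N+1)\<close>. Identities between infinite products are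
  checked modulo every such power, where finite products suffice.\<close>

definition agree_upto :: "nat \<Rightarrow> 'a fps \<Rightarrow> 'a fps \<Rightarrow> bool" where
  "agree_upto N f g \<longleftrightarrow> (\<forall>i\<le>N. fps_nth f i = fps_nth g i)"

lemma agree_upto_refl [simp]: "agree_upto N f f"
  by (simp add: agree_upto_def)

lemma agree_upto_sym: "agree_upto N f g \<Longrightarrow> agree_upto N g f"
  by (simp add: agree_upto_def)

lemma agree_upto_trans [trans]: "agree_upto N f g \<Longrightarrow> agree_upto N g h \<Longrightarrow> agree_upto N f h"
  by (simp add: agree_upto_def)

lemma agree_upto_nth: "agree_upto N f g \<Longrightarrow> i \<le> N \<Longrightarrow> fps_nth f i = fps_nth g i"
  by (simp add: agree_upto_def)

lemma agree_upto_mult: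
  fixes f g :: "'a :: comm_ring_1 fps"
  assumes "agree_upto N f f'" "agree_upto N g g'"
  shows "agree_upto N (f * g) (f' * g')"
  unfolding agree_upto_def fps_mult_nth
  by (intro allI impI sum.cong refl arg_cong2[of _ _ _ _ "(*)"]) (use assms in \<open>auto simp: agree_upto_def\<close>)

lemma agree_upto_sum:
  fixes f g :: "'b \<Rightarrow> 'a :: comm_ring_1 fps"
  assumes "\<And>x. x \<in> A \<Longrightarrow> agree_upto N (f x) (g x)"
  shows "agree_upto N (sum f A) (sum g A)"
  using assms by (auto simp: agree_upto_def fps_sum_nth intro!: sum.cong)

text \<open>Multiply the congruence of \<open>f\<close> and \<open>g\<close> by
  \<open>inverse f * inverse g\<close>; both constant terms are nonzero.\<close>

lemma agree_upto_inverse: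
  fixes f g :: "'a :: field fps"
  assumes "agree_upto N f g" "fps_nth f 0 \<noteq> 0"
  shows "agree_upto N (inverse f) (inverse g)"
proof -
  have g0: "fps_nth g 0 \<noteq> 0"
    using assms by (auto simp: agree_upto_def)
  have "agree_upto N (inverse f * inverse g * g) (inverse f * inverse g * f)"
    by (intro agree_upto_mult agree_upto_refl agree_upto_sym[OF assms(1)])
  moreover have "inverse f * inverse g * g = inverse f"
    using inverse_mult_eq_1[OF g0] by (simp add: mult.assoc)
  moreover have "inverse f * inverse g * f = inverse g"
    using inverse_mult_eq_1[OF assms(2)] by (simp add: mult.commute mult.left_commute)
  ultimately show ?thesis by simp
qed

lemma fps_eqI_agree_upto: "(\<And>N. agree_upto N f g) \<Longrightarrow> f = g"
  by (rule fps_ext) (auto simp: agree_upto_def)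

lemma agree_upto_fps_X_power_mult:
  fixes f :: "'a :: comm_ring_1 fps"
  shows "N < k \<Longrightarrow> agree_upto N (fps_X ^ k * f) 0"
  by (auto simp: agree_upto_def fps_X_power_mult_nth)

text \<open>The product \<open>\<Prod>\<^bsub>p \<in> P, p > 0\<^esub> (1 + c X\<^sup>p)\<close>; its \<open>N\<close>-th coefficient only involves the
  factors with \<open>p \<le> N\<close>. A possible element \<open>0\<close> of \<open>P\<close> is ignored.\<close>

definition fps_part_prod :: "'a :: comm_ring_1 \<Rightarrow> nat set \<Rightarrow> 'a fps" where
  "fps_part_prod c P =
     Abs_fps (\<lambda>N. fps_nth (\<Prod>p\<in>P \<inter> {1..N}. 1 + fps_const c * fps_X ^ p) N)"

lemma agree_upto_prod_1:
  fixes c :: "'a :: comm_ring_1"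
  assumes "\<And>p. p \<in> S \<Longrightarrow> N < p"
  shows "agree_upto N (\<Prod>p\<in>S. 1 + fps_const c * fps_X ^ p) 1"
  using assms
proof (induction S rule: infinite_finite_induct)
  case (insert p S)
  have "agree_upto N (1 + fps_const c * fps_X ^ p) 1"
    using insert.prems[of p] by (auto simp: agree_upto_def)
  from agree_upto_mult[OF this insert.IH] insert show ?case by simp
qed auto

text \<open>Factors with \<open>p > N\<close> are \<open>1\<close> modulo \<open>X^(N+1)\<close>.
  The freedom in \<open>S\<close> lets arithmetic progressions be cut at any sufficient
  length.\<close>

lemma agree_upto_fps_part_prod:
  assumes "finite S" "P \<inter> {1..N} \<subseteq> S" "S \<subseteq> P - {0}"
  shows "agree_upto N (fps_part_prod c P) (\<Prod>p\<in>S. 1 + fps_const c * fps_X ^ p)"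
  unfolding agree_upto_def
proof (intro allI impI)
  fix i assume i: "i \<le> N"
  let ?f = "\<lambda>p. 1 + fps_const c * fps_X ^ p"
  have sub: "P \<inter> {1..i} \<subseteq> S" using assms i by auto
  have split: "prod ?f S = prod ?f (P \<inter> {1..i}) * prod ?f (S - P \<inter> {1..i})"
    using prod.subset_diff[OF sub assms(1), of ?f] by (simp add: mult.commute)
  have "agree_upto i (prod ?f (S - P \<inter> {1..i})) 1"
    by (rule agree_upto_prod_1) (use assms in \<open>force simp: not_less\<close>)
  then have "agree_upto i (prod ?f S) (prod ?f (P \<inter> {1..i}) * 1)"
    unfolding split by (intro agree_upto_mult agree_upto_refl)
  then show "fps_nth (fps_part_prod c P) i = fps_nth (prod ?f S) i"
    by (simp add: fps_part_prod_def agree_upto_def)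
qed

lemma fps_part_prod_union:
  assumes "P \<inter> P' \<subseteq> {0}"
  shows "fps_part_prod c (P \<union> P') = fps_part_prod c P * fps_part_prod c P'"
proof (rule fps_eqI_agree_upto)
  fix N
  let ?f = "\<lambda>p. 1 + fps_const c * fps_X ^ p"
  have "agree_upto N (fps_part_prod c (P \<union> P')) (prod ?f (P \<inter> {1..N} \<union> P' \<inter> {1..N}))"
    by (rule agree_upto_fps_part_prod) auto
  also have "prod ?f (P \<inter> {1..N} \<union> P' \<inter> {1..N}) = prod ?f (P \<inter> {1..N}) * prod ?f (P' \<inter> {1..N})"
    using assms by (intro prod.union_disjoint) auto
  also have "agree_upto N \<dots> (fps_part_prod c P * fps_part_prod c P')"
    by (intro agree_upto_mult agree_upto_sym[OF agree_upto_fps_part_prod]) auto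
  finally show "agree_upto N (fps_part_prod c (P \<union> P')) (fps_part_prod c P * fps_part_prod c P')" .
qed

lemma fps_part_prod_nth_0 [simp]: "fps_nth (fps_part_prod c P) 0 = 1"
  by (simp add: fps_part_prod_def)

section \<open>Products as generating functions of distinct partitions\<close>

text \<open>Expanding the product chooses \<open>X^p\<close> or \<open>1\<close> from each factor,
  so a subset \<open>A\<close> contributes one monomial of degree \<open>\<Sum>A\<close>.\<close>

lemma fps_nth_part_prod:
  "fps_nth (fps_part_prod (1 :: 'a :: comm_ring_1) P) n = of_nat (card {A. A \<subseteq> P \<inter> {1..n} \<and> \<Sum>A = n})"
proof -
  have "(\<Prod>p\<in>P \<inter> {1..n}. 1 + fps_const 1 * fps_X ^ p :: 'a fps) = (\<Prod>p\<in>P \<inter> {1..n}. fps_X ^ p + 1)"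
    by (simp add: add.commute)
  also have "\<dots> = (\<Sum>A\<in>Pow (P \<inter> {1..n}). fps_X ^ \<Sum>A)"
    by (subst prod_add) (auto simp: power_sum)
  finally have "fps_nth (fps_part_prod (1 :: 'a) P) n =
      (\<Sum>A\<in>Pow (P \<inter> {1..n}). if n = \<Sum>A then 1 else 0)"
    by (simp add: fps_part_prod_def fps_sum_nth)
  also have "\<dots> = (\<Sum>A\<in>{A \<in> Pow (P \<inter> {1..n}). n = \<Sum>A}. 1)"
    by (subst sum.inter_filter) auto
  also have "\<dots> = of_nat (card {A. A \<subseteq> P \<inter> {1..n} \<and> \<Sum>A = n})"
    by (auto intro!: arg_cong[of _ _ "\<lambda>S. of_nat (card S)"])
  finally show ?thesis .
qed

text \<open>A non-increasing list without repetitions is determined by its set, and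
  \<open>rev (sorted_list_of_set A)\<close> recovers it.\<close>

lemma card_distinct_partitions:
  "card (distinct_partitions m R n) = card {A. A \<subseteq> {p. cong_pm m R p} \<inter> {1..n} \<and> \<Sum>A = n}"
proof (rule bij_betw_same_card[of set])
  have inj: "inj_on set (distinct_partitions m R n)"
  proof (rule inj_onI)
    fix xs ys assume "xs \<in> distinct_partitions m R n" "ys \<in> distinct_partitions m R n" "set xs = set ys"
    then have "rev xs = rev ys"
      by (intro sorted_distinct_set_unique)
         (auto simp: distinct_partitions_def is_partition_def sorted_wrt_rev)
    then show "xs = ys" by simp
  qed
  have "set ` distinct_partitions m R n = {A. A \<subseteq> {p. cong_pm m R p} \<inter> {1..n} \<and> \<Sum>A = n}"
  proof safe
    fix xs p assume xs: "xs \<in> distinct_partitions m R n"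
    then show "\<Sum>(set xs) = n"
      using sum_list_distinct_conv_sum_set[of xs "\<lambda>x. x"]
      by (simp add: distinct_partitions_def is_partition_def)
    assume "p \<in> set xs"
    with xs show "cong_pm m R p" "p \<in> {1..n}"
      using member_le_sum_list[of p xs]
      by (auto simp: distinct_partitions_def is_partition_def Suc_le_eq)
  next
    fix A assume A: "A \<subseteq> {p. cong_pm m R p} \<inter> {1..\<Sum>A}" and n: "n = \<Sum>A"
    then have fin: "finite A" by (meson finite_Int finite_atLeastAtMost finite_subset)
    let ?xs = "rev (sorted_list_of_set A)"
    have "?xs \<in> distinct_partitions m R (\<Sum>A)"
      using A fin sum_list_distinct_conv_sum_set[of ?xs "\<lambda>x. x"]
      by (auto simp: distinct_partitions_def is_partition_def sorted_wrt_rev)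
    moreover have "set ?xs = A" using fin by simp
    ultimately show "A \<in> set ` distinct_partitions m R (\<Sum>A)" by (metis imageI)
  qed
  with inj show "bij_betw set (distinct_partitions m R n)
      {A. A \<subseteq> {p. cong_pm m R p} \<inter> {1..n} \<and> \<Sum>A = n}"
    by (simp add: bij_betw_def)
qed

lemma card_distinct_partitions_eq_nth:
  "of_nat (card (distinct_partitions m R n)) =
     fps_nth (fps_part_prod (1 :: 'a :: comm_ring_1) {p. cong_pm m R p}) n"
  by (simp add: card_distinct_partitions fps_nth_part_prod)

section \<open>Gaussian binomial coefficients\<close>

definition q_poch :: "'a :: field fps \<Rightarrow> nat \<Rightarrow> 'a fps" where
  "q_poch Q n = (\<Prod>i<n. 1 - Q ^ Suc i)"

text \<open>Extension by \<open>0\<close> to all integers \<open>k\<close> lets sums over shifted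
  indices absorb their boundary terms.\<close>

definition gauss_binom :: "'a :: field fps \<Rightarrow> nat \<Rightarrow> int \<Rightarrow> 'a fps" where
  "gauss_binom Q N k = (if 0 \<le> k \<and> k \<le> int N
     then q_poch Q N * inverse (q_poch Q (nat k)) * inverse (q_poch Q (N - nat k)) else 0)"

context
  fixes Q :: "'a :: field fps"
  assumes Q0: "fps_nth Q 0 = 0"
begin

lemma q_poch_0 [simp]: "q_poch Q 0 = 1"
  by (simp add: q_poch_def)

lemma q_poch_Suc: "q_poch Q (Suc n) = q_poch Q n * (1 - Q ^ Suc n)"
  by (simp add: q_poch_def)

lemma nth_0_one_minus_Q_power: "fps_nth (1 - Q ^ Suc n) 0 = 1"
  by (simp add: Q0)

lemma q_poch_nth_0: "fps_nth (q_poch Q n) 0 = 1"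
proof (induction n)
  case (Suc n)
  then show ?case
    unfolding q_poch_Suc fps_mult_nth_0 nth_0_one_minus_Q_power by simp
qed simp

lemma gauss_binom_int:
  "gauss_binom Q (a + b) (int a) = q_poch Q (a + b) * inverse (q_poch Q a) * inverse (q_poch Q b)"
  by (simp add: gauss_binom_def)

lemma gauss_binom_edge [simp]:
  "gauss_binom Q N 0 = 1" "gauss_binom Q N (int N) = 1"
  using inverse_mult_eq_1'[of "q_poch Q N"]
  by (simp_all add: gauss_binom_def q_poch_nth_0 mult.commute)

lemma gauss_binom_symmetric: "gauss_binom Q N (int N - k) = gauss_binom Q N k"
proof (cases "0 \<le> k \<and> k \<le> int N")
  case True
  then obtain a b where "k = int a" "N = a + b"
    by (metis nonneg_int_cases le_Suc_ex of_nat_le_iff)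
  then show ?thesis by (simp add: gauss_binom_def mult_ac)
qed (auto simp: gauss_binom_def)

text \<open>The q-Pascal rule. With \<open>k = a + 1\<close> and \<open>N = a + b + 1\<close> it
  reduces to \<open>1 - Q^(a+b+2) = (1 - Q^(b+1)) + Q^(b+1) * (1 - Q^(a+1))\<close>.\<close>

lemma gauss_binom_Suc:
  assumes "k \<le> int N + 1"
  shows "gauss_binom Q (Suc N) k = gauss_binom Q N k + Q ^ nat (int N + 1 - k) * gauss_binom Q N (k - 1)"
proof -
  consider "k < 0" | "k = 0" | "k = int N + 1" | "0 < k" "k \<le> int N" using assms by linarith
  then show ?thesis
  proof cases
    case 2
    then show ?thesis by simp (simp add: gauss_binom_def)
  next
    case 3
    then show ?thesis
      using gauss_binom_edge(2)[of "Suc N"] by (simp add: gauss_binom_def[of Q N "1 + int N"] add.commute)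
  next
    case 4
    define a where "a = nat k - 1"
    define b where "b = N - nat k"
    have k: "k = int (Suc a)" and N: "N = Suc (a + b)"
      using 4 by (auto simp: a_def b_def)
    define u where "u = 1 - Q ^ Suc a"
    define v where "v = 1 - Q ^ Suc b"
    have u: "u * inverse u = 1" and v: "v * inverse v = 1"
      unfolding u_def v_def
      by (rule inverse_mult_eq_1', unfold nth_0_one_minus_Q_power, simp)+
    define A where "A = q_poch Q N * inverse (q_poch Q a) * inverse (q_poch Q b)"
    have 1: "gauss_binom Q (Suc N) k = A * (inverse u * inverse v * (1 - Q ^ Suc N))"
      using gauss_binom_int[of "Suc a" "Suc b"]
      by (simp add: N k A_def q_poch_Suc[of "Suc (a + b)"] q_poch_Suc[of a] q_poch_Suc[of b]
          fps_inverse_mult u_def v_def mult_ac del: of_nat_Suc)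
    have 2: "gauss_binom Q N k = A * (inverse u * (v * inverse v))"
      using gauss_binom_int[of "Suc a" b] unfolding v
      by (simp add: N k A_def q_poch_Suc[of a] fps_inverse_mult u_def mult_ac del: of_nat_Suc)
    have 3: "gauss_binom Q N (k - 1) = A * ((u * inverse u) * inverse v)"
      using gauss_binom_int[of a "Suc b"] unfolding u
      by (simp add: N k A_def q_poch_Suc[of b] fps_inverse_mult v_def mult_ac)
    have e: "nat (int N + 1 - k) = Suc b" by (simp add: k N)
    have eq: "1 - Q ^ Suc N = v + Q ^ Suc b * u"
      by (simp add: u_def v_def N algebra_simps power_add)
    show ?thesis
      unfolding 1 2 3 e eq by (simp add: algebra_simps)
  qed (auto simp: gauss_binom_def)
qed

text \<open>The companion rule, obtained by reflecting \<open>k\<close> to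
  \<open>N + 1 - k\<close>.\<close>

lemma gauss_binom_Suc':
  assumes "0 \<le> k"
  shows "gauss_binom Q (Suc N) k = gauss_binom Q N (k - 1) + Q ^ nat k * gauss_binom Q N k"
proof -
  have "gauss_binom Q (Suc N) k = gauss_binom Q (Suc N) (int (Suc N) - k)"
    by (rule gauss_binom_symmetric[symmetric])
  also have "\<dots> = gauss_binom Q N (int N - (k - 1)) + Q ^ nat k * gauss_binom Q N (int N - k)"
    using assms by (subst gauss_binom_Suc) (auto simp: algebra_simps)
  finally show ?thesis by (simp only: gauss_binom_symmetric)
qed

end

section \<open>The Jacobi triple product\<close>

definition tri :: "int \<Rightarrow> int" where
  "tri j = j * (j + 1) div 2"

lemma two_tri: "2 * tri j = j * (j + 1)"
  by (simp add: tri_def)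

lemma tri_add_1: "tri (j + 1) = tri j + j + 1"
proof -
  have "2 * tri (j + 1) = 2 * (tri j + j + 1)"
    unfolding two_tri distrib_left by (simp add: algebra_simps)
  then show ?thesis by simp
qed

lemma tri_nonneg: "tri j \<ge> 0"
proof -
  have "j * (j + 1) \<ge> 0"
    by (cases "j \<ge> 0") (auto simp: mult_nonpos_nonpos)
  then show ?thesis using two_tri[of j] by linarith
qed

text \<open>The exponents of Ramanujan's theta function
  \<open>f(X\<^sup>a, X\<^sup>b) = \<Sum>\<^bsub>j\<^esub> X\<^bsup>a j(j+1)/2 + b j(j-1)/2\<^esup>\<close>.\<close>

definition theta_exp :: "nat \<Rightarrow> nat \<Rightarrow> int \<Rightarrow> int" where
  "theta_exp a b j = int a * tri j + int b * tri (j - 1)"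

lemma theta_exp_nonneg: "theta_exp a b j \<ge> 0"
  by (simp add: theta_exp_def tri_nonneg)

lemma theta_exp_add_1: "theta_exp a b (j + 1) = theta_exp a b j + int a * (j + 1) + int b * j"
  using tri_add_1[of j] tri_add_1[of "j - 1"] by (simp add: theta_exp_def algebra_simps)

lemma theta_exp_eq:
  assumes "a + b = 2 * h"
  shows "theta_exp a b j = int h * (j * (j - 1)) + int a * j"
proof -
  have b: "int b = 2 * int h - int a" using assms by linarith
  have "2 * theta_exp a b j = int a * (2 * tri j) + int b * (2 * tri (j - 1))"
    by (simp add: theta_exp_def)
  also have "\<dots> = 2 * (int h * (j * (j - 1)) + int a * j)"
    unfolding two_tri b by (simp add: algebra_simps)
  finally show ?thesis by simp
qed

text \<open>\<open>tri j + tri (j - 1)\<close> is \<open>j * j\<close>, which dominates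
  \<open>\<bar>j\<bar>\<close>. Hence each exponent occurs finitely often, and only finitely many
  indices matter modulo \<open>X^(N+1)\<close>.\<close>

lemma abs_le_theta_exp:
  assumes "a > 0" "b > 0"
  shows "\<bar>j\<bar> \<le> theta_exp a b j"
proof -
  have "2 * (tri j + tri (j - 1)) = 2 * (j * j)"
    unfolding distrib_left two_tri by (simp add: algebra_simps)
  then have "tri j + tri (j - 1) = j * j" by simp
  moreover have "tri j \<le> int a * tri j" "tri (j - 1) \<le> int b * tri (j - 1)"
    using assms mult_right_mono[of 1 "int a" "tri j"] mult_right_mono[of 1 "int b" "tri (j - 1)"]
    by (simp_all add: tri_nonneg)
  moreover have "\<bar>j\<bar> \<le> j * j"
  proof (cases "j = 0")
    case False
    then have "\<bar>j\<bar> * 1 \<le> \<bar>j\<bar> * \<bar>j\<bar>" by (intro mult_left_mono) auto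
    then show ?thesis by simp
  qed simp
  ultimately show ?thesis by (simp add: theta_exp_def)
qed

text \<open>The formal sum of \<open>w i * X^(f i)\<close>, meant for nonnegative \<open>f\<close>
  with finite fibres: a sum over an infinite fibre would have the default value
  \<open>0\<close>.\<close>

definition index_series :: "('i \<Rightarrow> int) \<Rightarrow> ('i \<Rightarrow> 'a :: comm_ring_1) \<Rightarrow> 'a fps" where
  "index_series f w = Abs_fps (\<lambda>N. \<Sum>i | f i = int N. w i)"

text \<open>In Ramanujan's notation this is \<open>f(c X^a, c^(-1) X^b)\<close>.\<close>

definition theta :: "'a :: field \<Rightarrow> nat \<Rightarrow> nat \<Rightarrow> 'a fps" where
  "theta c a b = index_series (theta_exp a b) (\<lambda>j. c powi j)"

definition theta_term :: "'a :: field \<Rightarrow> nat \<Rightarrow> nat \<Rightarrow> int \<Rightarrow> 'a fps" where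
  "theta_term c a b j = fps_const (c powi j) * fps_X ^ nat (theta_exp a b j)"

section \<open>The finite form of the triple product\<close>

text \<open>Successive exponents differ by \<open>a + (a + b) * j\<close>, so the monomial of a new
  factor moves term \<open>j\<close> to \<open>j + 1\<close> and leaves the power of
  \<open>X^(a+b)\<close> that occurs in the q-Pascal rule.\<close>

lemma theta_term_up:
  fixes c :: "'a :: field"
  assumes "c \<noteq> 0" "j \<le> int m"
  shows "fps_const c * fps_X ^ (a + (a + b) * m) * theta_term c a b j =
           (fps_X ^ (a + b)) ^ nat (int m - j) * theta_term c a b (j + 1)"
proof -
  have "int (a + (a + b) * m + nat (theta_exp a b j)) =
      int ((a + b) * nat (int m - j) + nat (theta_exp a b (j + 1)))"
    using assms theta_exp_nonneg[of a b j] theta_exp_nonneg[of a b "j + 1"]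
      theta_exp_add_1[of a b j]
    by (simp add: algebra_simps)
  then have e: "a + (a + b) * m + nat (theta_exp a b j) =
      (a + b) * nat (int m - j) + nat (theta_exp a b (j + 1))"
    by (simp only: of_nat_eq_iff)
  have X: "fps_X ^ ((a + b) * nat (int m - j) + nat (theta_exp a b (j + 1))) =
      (fps_X ^ (a + b)) ^ nat (int m - j) * (fps_X ^ nat (theta_exp a b (j + 1)) :: 'a fps)"
    by (simp only: power_add[of _ "(a + b) * nat (int m - j)"] power_mult)
  have "fps_const c * fps_X ^ (a + (a + b) * m) * theta_term c a b j =
      fps_const (c * c powi j) * fps_X ^ (a + (a + b) * m + nat (theta_exp a b j))"
    by (simp only: theta_term_def power_add fps_const_mult[symmetric] mult_ac)
  also have "c * c powi j = c powi (j + 1)"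
    using assms(1) by (simp add: power_int_add mult.commute)
  finally show ?thesis
    unfolding e X theta_term_def by (simp only: mult_ac)
qed

lemma theta_term_down:
  fixes c :: "'a :: field"
  assumes "c \<noteq> 0" "- int n \<le> j"
  shows "fps_const (inverse c) * fps_X ^ (b + (a + b) * n) * theta_term c a b j =
           (fps_X ^ (a + b)) ^ nat (int n + j) * theta_term c a b (j - 1)"
proof -
  have "int (b + (a + b) * n + nat (theta_exp a b j)) =
      int ((a + b) * nat (int n + j) + nat (theta_exp a b (j - 1)))"
    using assms theta_exp_nonneg[of a b j] theta_exp_nonneg[of a b "j - 1"]
      theta_exp_add_1[of a b "j - 1"]
    by (simp add: algebra_simps)
  then have e: "b + (a + b) * n + nat (theta_exp a b j) =
      (a + b) * nat (int n + j) + nat (theta_exp a b (j - 1))"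
    by (simp only: of_nat_eq_iff)
  have X: "fps_X ^ ((a + b) * nat (int n + j) + nat (theta_exp a b (j - 1))) =
      (fps_X ^ (a + b)) ^ nat (int n + j) * (fps_X ^ nat (theta_exp a b (j - 1)) :: 'a fps)"
    by (simp only: power_add[of _ "(a + b) * nat (int n + j)"] power_mult)
  have "fps_const (inverse c) * fps_X ^ (b + (a + b) * n) * theta_term c a b j =
      fps_const (inverse c * c powi j) * fps_X ^ (b + (a + b) * n + nat (theta_exp a b j))"
    by (simp only: theta_term_def power_add fps_const_mult[symmetric] mult_ac)
  also have "inverse c * c powi j = c powi (j - 1)"
    using assms(1) by (simp add: power_int_diff field_simps)
  finally show ?thesis
    unfolding e X theta_term_def by (simp only: mult_ac)
qed

context
  fixes a b :: nat and c :: "'a :: field"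
  assumes ab: "a > 0" "b > 0" and c: "c \<noteq> 0"
begin

private abbreviation "Q \<equiv> fps_X ^ (a + b) :: 'a fps"
private abbreviation "T \<equiv> theta_term c a b"

private lemma Q0: "fps_nth Q 0 = 0"
  using ab by simp

private definition S :: "nat \<Rightarrow> nat \<Rightarrow> 'a fps" where
  "S m n = (\<Sum>j\<in>{-int n..int m}. gauss_binom Q (m + n) (j + int n) * T j)"

text \<open>Apply the q-Pascal rule to each binomial: the first parts sum to \<open>S m n\<close>;
  the second parts, reindexed by one, give \<open>S m n\<close> times the monomial of the new
  factor.\<close>

private lemma S_Suc_left: "S (Suc m) n = S m n * (1 + fps_const c * fps_X ^ (a + (a + b) * m))"
proof -
  let ?g = "\<lambda>k. gauss_binom Q (m + n) k"
  have "S (Suc m) n = (\<Sum>j\<in>{-int n..int m + 1}.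
      ?g (j + int n) * T j + Q ^ nat (int m + 1 - j) * ?g (j + int n - 1) * T j)"
    unfolding S_def
    by (intro sum.cong) (auto simp: gauss_binom_Suc[OF Q0] algebra_simps)
  also have "\<dots> = (\<Sum>j\<in>{-int n..int m + 1}. ?g (j + int n) * T j)
      + (\<Sum>j\<in>{-int n..int m + 1}. Q ^ nat (int m + 1 - j) * ?g (j + int n - 1) * T j)"
    by (rule sum.distrib)
  \<comment> \<open>The extra index \<open>j = m + 1\<close> has lower index
    \<open>m + n + 1\<close>, where the binomial is \<open>0\<close>.\<close>
  also have "(\<Sum>j\<in>{-int n..int m + 1}. ?g (j + int n) * T j) = S m n"
    unfolding S_def by (rule sum.mono_neutral_right) (auto simp: gauss_binom_def)
  also have "(\<Sum>j\<in>{-int n..int m + 1}. Q ^ nat (int m + 1 - j) * ?g (j + int n - 1) * T j)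
      = (\<Sum>j\<in>{-int n + 1..int m + 1}. Q ^ nat (int m + 1 - j) * ?g (j + int n - 1) * T j)"
    by (rule sum.mono_neutral_right) (auto simp: gauss_binom_def)
  also have "\<dots> = (\<Sum>j\<in>{-int n..int m}. ?g (j + int n) * (Q ^ nat (int m - j) * T (j + 1)))"
    by (rule sum.reindex_bij_witness[of _ "\<lambda>j. j + 1" "\<lambda>j. j - 1"]) (auto simp: algebra_simps)
  also have "\<dots> = (\<Sum>j\<in>{-int n..int m}. ?g (j + int n) *
      (fps_const c * fps_X ^ (a + (a + b) * m) * T j))"
    by (intro sum.cong refl arg_cong2[of _ _ _ _ "(*)"] theta_term_up[OF c, symmetric]) auto
  also have "\<dots> = S m n * (fps_const c * fps_X ^ (a + (a + b) * m))"
    unfolding S_def sum_distrib_right by (intro sum.cong) (simp_all only: mult_ac)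
  finally show ?thesis by (simp add: algebra_simps)
qed

text \<open>A new factor on the \<open>b\<close> side extends the range of \<open>j\<close>
  downwards, which calls for the companion rule.\<close>

private lemma S_Suc_right:
  "S m (Suc n) = S m n * (1 + fps_const (inverse c) * fps_X ^ (b + (a + b) * n))"
proof -
  let ?g = "\<lambda>k. gauss_binom Q (m + n) k"
  have "S m (Suc n) = (\<Sum>j\<in>{-int n - 1..int m}.
      ?g (j + int n) * T j + Q ^ nat (int n + 1 + j) * ?g (j + int n + 1) * T j)"
    unfolding S_def
    by (intro sum.cong) (auto simp: gauss_binom_Suc'[OF Q0] algebra_simps)
  also have "\<dots> = (\<Sum>j\<in>{-int n - 1..int m}. ?g (j + int n) * T j)
      + (\<Sum>j\<in>{-int n - 1..int m}. Q ^ nat (int n + 1 + j) * ?g (j + int n + 1) * T j)"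
    by (rule sum.distrib)
  also have "(\<Sum>j\<in>{-int n - 1..int m}. ?g (j + int n) * T j) = S m n"
    unfolding S_def by (rule sum.mono_neutral_right) (auto simp: gauss_binom_def)
  also have "(\<Sum>j\<in>{-int n - 1..int m}. Q ^ nat (int n + 1 + j) * ?g (j + int n + 1) * T j)
      = (\<Sum>j\<in>{-int n - 1..int m - 1}. Q ^ nat (int n + 1 + j) * ?g (j + int n + 1) * T j)"
    by (rule sum.mono_neutral_right) (auto simp: gauss_binom_def)
  also have "\<dots> = (\<Sum>j\<in>{-int n..int m}. ?g (j + int n) * (Q ^ nat (int n + j) * T (j - 1)))"
    by (rule sum.reindex_bij_witness[of _ "\<lambda>j. j - 1" "\<lambda>j. j + 1"]) (auto simp: algebra_simps)
  also have "\<dots> = (\<Sum>j\<in>{-int n..int m}. ?g (j + int n) *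
      (fps_const (inverse c) * fps_X ^ (b + (a + b) * n) * T j))"
    by (intro sum.cong refl arg_cong2[of _ _ _ _ "(*)"] theta_term_down[OF c, symmetric]) auto
  also have "\<dots> = S m n * (fps_const (inverse c) * fps_X ^ (b + (a + b) * n))"
    unfolding S_def sum_distrib_right by (intro sum.cong) (simp_all only: mult_ac)
  finally show ?thesis by (simp add: algebra_simps)
qed

lemma finite_jacobi_triple_product:
  "(\<Prod>i<m. 1 + fps_const c * fps_X ^ (a + (a + b) * i)) *
   (\<Prod>i<n. 1 + fps_const (inverse c) * fps_X ^ (b + (a + b) * i)) =
     (\<Sum>j\<in>{-int n..int m}. gauss_binom (fps_X ^ (a + b)) (m + n) (j + int n) * theta_term c a b j)"
proof -
  \<comment> \<open>From this base case, factors are attached first on the \<open>a\<close> side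
    with \<open>n = 0\<close>, then on the \<open>b\<close> side.\<close>
  have "S 0 0 = 1"
    by (simp add: S_def theta_term_def theta_exp_def tri_def gauss_binom_edge[OF Q0])
  then have "S m 0 = (\<Prod>i<m. 1 + fps_const c * fps_X ^ (a + (a + b) * i))"
    by (induction m) (simp_all only: S_Suc_left prod.lessThan_Suc lessThan_0 prod.empty)
  then have "S m n = (\<Prod>i<m. 1 + fps_const c * fps_X ^ (a + (a + b) * i)) *
      (\<Prod>i<n. 1 + fps_const (inverse c) * fps_X ^ (b + (a + b) * i))"
    by (induction n) (simp_all only: S_Suc_right prod.lessThan_Suc lessThan_0 prod.empty mult_1_right mult.assoc)
  then show ?thesis by (simp only: S_def)
qed

end

section \<open>Passage to the infinite product\<close>

lemma agree_upto_residue_prod: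
  assumes "0 < a" "a < s" "N < n"
  shows "agree_upto N (fps_part_prod c {p. p mod s = a}) (\<Prod>i<n. 1 + fps_const c * fps_X ^ (a + s * i))"
proof -
  have "inj_on (\<lambda>i. a + s * i) {..<n}" using assms by (auto simp: inj_on_def)
  then have "(\<Prod>i<n. 1 + fps_const c * fps_X ^ (a + s * i)) =
      (\<Prod>p\<in>(\<lambda>i. a + s * i) ` {..<n}. 1 + fps_const c * fps_X ^ p)"
    by (simp add: prod.reindex)
  moreover have "p \<in> (\<lambda>i. a + s * i) ` {..<n}" if "p mod s = a" "p \<le> N" for p
  proof (rule image_eqI[of _ _ "p div s"])
    show "p = a + s * (p div s)" using that(1) mod_mult_div_eq[of p s] by simp
    show "p div s \<in> {..<n}" using assms that(2) div_le_dividend[of p s] unfolding lessThan_iff by linarith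
  qed
  ultimately show ?thesis
    using assms by (auto intro!: agree_upto_fps_part_prod)
qed

lemma agree_upto_q_poch:
  assumes "0 < s" "N \<le> n"
  shows "agree_upto N (fps_part_prod (-1) {p. s dvd p}) (q_poch (fps_X ^ s) n)"
proof -
  have "inj_on (\<lambda>i. s * Suc i) {..<n}" using assms by (auto simp: inj_on_def)
  then have "q_poch (fps_X ^ s) n = (\<Prod>p\<in>(\<lambda>i. s * Suc i) ` {..<n}. 1 + fps_const (-1 :: 'a) * fps_X ^ p)"
    unfolding q_poch_def
    by (simp add: prod.reindex power_mult[symmetric] fps_const_neg[symmetric]
        del: power_Suc mult_Suc_right fps_const_neg)
  moreover have "p \<in> (\<lambda>i. s * Suc i) ` {..<n}" if "s dvd p" "p \<le> N" "1 \<le> p" for p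
  \<comment> \<open>Factor \<open>i\<close> of \<open>q_poch\<close> has exponent
    \<open>s * (i + 1)\<close>, hence the shift by one.\<close>
  proof (rule image_eqI[of _ _ "p div s - 1"])
    have pos: "p div s > 0" using that assms by (auto elim!: dvdE)
    then show "p = s * Suc (p div s - 1)" using that by simp
    show "p div s - 1 \<in> {..<n}" using assms that(2) pos div_le_dividend[of p s] unfolding lessThan_iff by linarith
  qed
  ultimately show ?thesis
    using assms by (auto intro!: agree_upto_fps_part_prod)
qed

text \<open>Multiply the finite identity with \<open>m = n\<close> by the Euler product
  \<open>?E\<close>. Modulo \<open>X^(N+1)\<close> the relevant binomials become
  \<open>inverse ?E\<close> and cancel; terms of larger exponent vanish.\<close>

theorem jacobi_triple_product:
  fixes c :: "'a :: field"
  assumes ab: "a > 0" "b > 0" and c: "c \<noteq> 0"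
  shows "fps_part_prod c {p. p mod (a + b) = a} * fps_part_prod (inverse c) {p. p mod (a + b) = b} *
           fps_part_prod (-1) {p. (a + b) dvd p} = theta c a b"
proof (rule fps_eqI_agree_upto)
  fix N
  \<comment> \<open>For \<open>\<bar>j\<bar> \<le> N\<close> this keeps \<open>n + j\<close> and
    \<open>n - j\<close> above \<open>N\<close>, so all three Pochhammer symbols in the binomial
    agree with \<open>?E\<close> up to degree \<open>N\<close>.\<close>
  define n where "n = Suc (2 * N)"
  let ?Q = "fps_X ^ (a + b) :: 'a fps"
  let ?E = "fps_part_prod (-1) {p. (a + b) dvd p} :: 'a fps"
  have Q0: "fps_nth ?Q 0 = 0" using ab by simp
  have E: "agree_upto N (q_poch ?Q k) ?E" if "N \<le> k" for k
    using that ab by (intro agree_upto_sym[OF agree_upto_q_poch]) auto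
  have EI: "?E * inverse ?E = 1" by (rule inverse_mult_eq_1') simp
  have summand: "agree_upto N (gauss_binom ?Q (n + n) (j + int n) * theta_term c a b j * ?E)
      (theta_term c a b j)" if j: "j \<in> {-int n..int n}" for j
  proof (cases "theta_exp a b j \<le> int N")
    case False
    then have N: "N < nat (theta_exp a b j)" by simp
    have "agree_upto N (gauss_binom ?Q (n + n) (j + int n) * theta_term c a b j * ?E) 0"
      using agree_upto_fps_X_power_mult[OF N,
          of "gauss_binom ?Q (n + n) (j + int n) * fps_const (c powi j) * ?E"]
      by (simp add: theta_term_def mult_ac)
    moreover have "agree_upto N (theta_term c a b j) 0"
      using agree_upto_fps_X_power_mult[OF N, of "fps_const (c powi j)"]
      by (simp add: theta_term_def mult_ac)
    ultimately show ?thesis by (metis agree_upto_sym agree_upto_trans)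
  next
    case True
    then have jN: "\<bar>j\<bar> \<le> int N" using abs_le_theta_exp[OF ab, of j] by linarith
    have "gauss_binom ?Q (n + n) (j + int n) = q_poch ?Q (n + n) *
        inverse (q_poch ?Q (nat (j + int n))) * inverse (q_poch ?Q (n + n - nat (j + int n)))"
      using j by (simp add: gauss_binom_def)
    also have "agree_upto N \<dots> (?E * inverse ?E * inverse ?E)"
      using jN by (intro agree_upto_mult agree_upto_inverse E)
        (auto simp: q_poch_nth_0[OF Q0] n_def)
    finally have "agree_upto N (gauss_binom ?Q (n + n) (j + int n) * theta_term c a b j * ?E)
        (?E * inverse ?E * inverse ?E * theta_term c a b j * ?E)"
      by (intro agree_upto_mult agree_upto_refl)
    also have "?E * inverse ?E * inverse ?E * theta_term c a b j * ?E =
        (?E * inverse ?E) * (?E * inverse ?E) * theta_term c a b j"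
      by (simp only: mult_ac)
    finally show ?thesis by (simp only: EI mult_1_left)
  qed
  have "agree_upto N (fps_part_prod c {p. p mod (a + b) = a} *
        fps_part_prod (inverse c) {p. p mod (a + b) = b} * ?E)
      ((\<Prod>i<n. 1 + fps_const c * fps_X ^ (a + (a + b) * i)) *
       (\<Prod>i<n. 1 + fps_const (inverse c) * fps_X ^ (b + (a + b) * i)) * ?E)"
    using ab by (intro agree_upto_mult agree_upto_residue_prod agree_upto_refl) (auto simp: n_def)
  also have "\<dots> = (\<Sum>j\<in>{-int n..int n}.
      gauss_binom ?Q (n + n) (j + int n) * theta_term c a b j * ?E)"
    by (simp only: finite_jacobi_triple_product[OF ab c] sum_distrib_right)
  also have "agree_upto N \<dots> (\<Sum>j\<in>{-int n..int n}. theta_term c a b j)"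
    by (intro agree_upto_sum summand)
  also have "agree_upto N \<dots> (theta c a b)"
    unfolding agree_upto_def
  proof (intro allI impI)
    fix i assume i: "i \<le> N"
    have "fps_nth (\<Sum>j\<in>{-int n..int n}. theta_term c a b j) i =
        (\<Sum>j\<in>{-int n..int n}. if theta_exp a b j = int i then c powi j else 0)"
      unfolding fps_sum_nth
    proof (rule sum.cong)
      fix j
      show "fps_nth (theta_term c a b j) i = (if theta_exp a b j = int i then c powi j else 0)"
        using theta_exp_nonneg[of a b j] by (auto simp: theta_term_def)
    qed simp
    also have "\<dots> = (\<Sum>j\<in>{j\<in>{-int n..int n}. theta_exp a b j = int i}. c powi j)"
      by (rule sum.inter_filter[symmetric]) simp
    also have "{j\<in>{-int n..int n}. theta_exp a b j = int i} = {j. theta_exp a b j = int i}"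
    proof -
      have "- int n \<le> j \<and> j \<le> int n" if "theta_exp a b j = int i" for j
        using abs_le_theta_exp[OF ab, of j] that i by (auto simp: n_def)
      then show ?thesis by auto
    qed
    finally show "fps_nth (\<Sum>j\<in>{-int n..int n}. theta_term c a b j) i = fps_nth (theta c a b) i"
      by (simp add: theta_def index_series_def)
  qed
  finally show "agree_upto N (fps_part_prod c {p. p mod (a + b) = a} *
      fps_part_prod (inverse c) {p. p mod (a + b) = b} * ?E) (theta c a b)" .
qed

section \<open>A quintuple product identity\<close>

text \<open>The Cauchy product groups the pairs by the exponent \<open>k\<close> of the first
  component.\<close>

lemma index_series_mult:
  fixes w :: "'i \<Rightarrow> 'a :: comm_ring_1" and v :: "'j \<Rightarrow> 'a"
  assumes f: "\<And>i. f i \<ge> 0" "\<And>N. finite {i. f i = int N}"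
    and g: "\<And>j. g j \<ge> 0" "\<And>N. finite {j. g j = int N}"
  shows "index_series f w * index_series g v =
           index_series (\<lambda>(i, j). f i + g j) (\<lambda>(i, j). w i * v j)"
proof (rule fps_ext)
  fix N
  let ?F = "\<lambda>k. {i. f i = int k}" and ?G = "\<lambda>k. {j. g j = int k}"
  have "{(i, j). f i + g j = int N} = (\<Union>k\<in>{0..N}. ?F k \<times> ?G (N - k))"
  proof (safe, goal_cases)
    case (1 i j)
    with f(1)[of i] g(1)[of j] show ?case
      by (intro UN_I[of "nat (f i)"]) auto
  qed auto
  moreover have "(\<Sum>x\<in>(\<Union>k\<in>{0..N}. ?F k \<times> ?G (N - k)). case x of (i, j) \<Rightarrow> w i * v j) =
      (\<Sum>k=0..N. \<Sum>(i, j)\<in>?F k \<times> ?G (N - k). w i * v j)"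
    by (rule sum.UNION_disjoint) (auto intro!: finite_cartesian_product f(2) g(2) simp del: of_nat_diff)
  ultimately show "fps_nth (index_series f w * index_series g v) N =
      fps_nth (index_series (\<lambda>(i, j). f i + g j) (\<lambda>(i, j). w i * v j)) N"
    by (simp add: index_series_def fps_mult_nth sum_product sum.cartesian_product case_prod_unfold)
qed

lemma fps_X_mult_index_series:
  assumes "\<And>i. f i \<ge> 0"
  shows "fps_X * index_series f w = index_series (\<lambda>i. f i + 1) w"
proof (rule fps_ext)
  fix N
  have "{i. f i + 1 = int N} = (if N = 0 then {} else {i. f i = int (N - 1)})"
  proof (cases N)
    case 0
    have "f i + 1 \<noteq> 0" for i using assms[of i] by linarith
    then show ?thesis using 0 by simp
  qed auto
  then show "fps_nth (fps_X * index_series f w) N = fps_nth (index_series (\<lambda>i. f i + 1) w) N"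
    by (simp add: index_series_def)
qed

lemma finite_theta_exp_eq:
  assumes "a > 0" "b > 0"
  shows "finite {j. theta_exp a b j = N}"
proof (rule finite_subset)
  show "{j. theta_exp a b j = N} \<subseteq> {-N..N}"
  proof
    fix j assume "j \<in> {j. theta_exp a b j = N}"
    with abs_le_theta_exp[OF assms, of j] show "j \<in> {-N..N}" by auto
  qed
qed simp

section \<open>Counting lattice points by parity\<close>

lemma card_pairs_eq:
  assumes "\<And>x y. (x, y) \<in> A \<Longrightarrow> (f x y, f' x y) \<in> B \<and> g (f x y) (f' x y) = x \<and> g' (f x y) (f' x y) = y"
    and "\<And>x y. (x, y) \<in> B \<Longrightarrow> (g x y, g' x y) \<in> A \<and> f (g x y) (g' x y) = x \<and> f' (g x y) (g' x y) = y"
  shows "card A = card B"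
  by (rule bij_betw_same_card[of "\<lambda>(x, y). (f x y, f' x y)"],
      rule bij_betw_byWitness[of _ "\<lambda>(x, y). (g x y, g' x y)"]) (use assms in auto)

text \<open>Writing \<open>y = 2*t - x\<close> parametrizes the pairs of even sum freely by
  \<open>(x, t)\<close>, which removes the parity condition before a change of variables.\<close>

lemma card_even_pairs:
  fixes F :: "int \<Rightarrow> int \<Rightarrow> int"
  shows "card ({(x, y). F x y = N} \<inter> {(x, y). even (x + y)}) = card {(x, t). F x (2*t - x) = N}"
proof -
  have "{(x, y). F x y = N} \<inter> {(x, y). even (x + y)} = (\<lambda>(x, t). (x, 2*t - x)) ` {(x, t). F x (2*t - x) = N}"
  proof (intro equalityI subsetI)
    fix z assume "z \<in> {(x, y). F x y = N} \<inter> {(x, y). even (x + y)}"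
    then obtain x y where z: "z = (x, y)" "F x y = N" "even (x + y)" by auto
    from z(3) obtain t where "x + y = 2 * t" by (elim evenE)
    then have "y = 2*t - x" by simp
    with z show "z \<in> (\<lambda>(x, t). (x, 2*t - x)) ` {(x, t). F x (2*t - x) = N}"
      by (intro image_eqI[of _ _ "(x, t)"]) auto
  qed auto
  then show ?thesis by (simp add: card_image inj_on_def)
qed

lemma card_odd_pairs:
  fixes F :: "int \<Rightarrow> int \<Rightarrow> int"
  shows "card ({(x, y). F x y = N} - {(x, y). even (x + y)}) = card {(x, t). F x (2*t + 1 - x) = N}"
proof -
  have "{(x, y). F x y = N} - {(x, y). even (x + y)} =
      (\<lambda>(x, t). (x, 2*t + 1 - x)) ` {(x, t). F x (2*t + 1 - x) = N}"
  proof (intro equalityI subsetI)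
    fix z assume "z \<in> {(x, y). F x y = N} - {(x, y). even (x + y)}"
    then obtain x y where z: "z = (x, y)" "F x y = N" "odd (x + y)" by auto
    from z(3) obtain t where "x + y = 2 * t + 1" by (elim oddE)
    then have "y = 2*t + 1 - x" by simp
    with z show "z \<in> (\<lambda>(x, t). (x, 2*t + 1 - x)) ` {(x, t). F x (2*t + 1 - x) = N}"
      by (intro image_eqI[of _ _ "(x, t)"]) auto
  qed auto
  then show ?thesis by (simp add: card_image inj_on_def)
qed

lemma finite_pair_fibre:
  fixes f :: "'i \<Rightarrow> int" and g :: "'j \<Rightarrow> int"
  assumes "\<And>i. f i \<ge> 0" "\<And>N. finite {i. f i = int N}" "\<And>j. g j \<ge> 0" "\<And>N. finite {j. g j = int N}"
  shows "finite {(i, j). f i + g j = int N}"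
proof (rule finite_subset)
  show "{(i, j). f i + g j = int N} \<subseteq> (\<Union>k\<in>{0..N}. {i. f i = int k}) \<times> (\<Union>k\<in>{0..N}. {j. g j = int k})"
  proof (safe, goal_cases)
    case (1 i j)
    with assms(1)[of i] assms(3)[of j] show ?case by (intro UN_I[of "nat (f i)"]) auto
  next
    case (2 i j)
    with assms(1)[of i] assms(3)[of j] show ?case by (intro UN_I[of "nat (g j)"]) auto
  qed
qed (use assms in auto)

lemma powi_minus_one: "(-1 :: 'a :: field) powi j = (if even j then 1 else -1)"
  by (simp add: power_int_minus_left)

text \<open>The left coefficient is \<open>card ?L1 - card ?L2\<close>, the right one counts even
  minus odd points of \<open>?R\<close>, where parity is that of the coordinate sum. Linear
  bijections match even \<open>?L1\<close> with even \<open>?R\<close>, odd \<open>?L2\<close> with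
  odd \<open>?R\<close>, and odd \<open>?L1\<close> with even \<open>?L2\<close>; the last two
  cancel.\<close>

theorem theta_quintuple_product:
  fixes h :: nat
  assumes h: "h \<ge> 2"
  shows "(theta 1 (2*h+3) (4*h-3) - fps_X * theta 1 (2*h-3) (4*h+3)) * theta 1 1 (2*h-1) =
           (theta (-1) (2*h) (4*h) * theta (-1) 2 (2*h-2) :: 'a :: field fps)"
proof (rule fps_ext)
  fix N
  define H where "H = int h"
  define A where "A = theta_exp (2*h+3) (4*h-3)"
  \<comment> \<open>The summand \<open>1\<close> accounts for the factor
    \<open>fps_X\<close>.\<close>
  define B where "B = (\<lambda>n. theta_exp (2*h-3) (4*h+3) n + 1)"
  define C where "C = theta_exp 1 (2*h-1)"
  define K where "K = theta_exp (2*h) (4*h)"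
  define J where "J = theta_exp 2 (2*h-2)"
  have A: "A n = 3*H*n*(n-1) + (2*H+3)*n" for n
    unfolding A_def H_def using h by (subst theta_exp_eq[of _ _ "3*h"]) (auto simp: algebra_simps)
  have B: "B n = 3*H*n*(n-1) + (2*H-3)*n + 1" for n
    unfolding B_def H_def using h
    by (subst theta_exp_eq[of _ _ "3*h"]) (auto simp: algebra_simps)
  have C: "C n = H*n*(n-1) + n" for n
    unfolding C_def H_def using h by (subst theta_exp_eq[of _ _ h]) (auto simp: algebra_simps)
  have K: "K n = 3*H*n*(n-1) + 2*H*n" for n
    unfolding K_def H_def using h by (subst theta_exp_eq[of _ _ "3*h"]) (auto simp: algebra_simps)
  have J: "J n = H*n*(n-1) + 2*n" for n
    unfolding J_def H_def using h by (subst theta_exp_eq[of _ _ h]) (auto simp: algebra_simps)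
  have nonneg: "A n \<ge> 0" "B n \<ge> 0" "C n \<ge> 0" "K n \<ge> 0" "J n \<ge> 0" for n
    unfolding A_def B_def C_def K_def J_def
    by (simp_all add: theta_exp_nonneg)
  have fin: "finite {n. A n = int M}" "finite {n. B n = int M}" "finite {n. C n = int M}"
    "finite {n. K n = int M}" "finite {n. J n = int M}" for M
  proof -
    have "{n. B n = int M} = {n. theta_exp (2*h-3) (4*h+3) n = int M - 1}"
      by (auto simp: B_def)
    then show "finite {n. B n = int M}" using h by (simp add: finite_theta_exp_eq)
  qed (use h in \<open>auto simp: A_def C_def K_def J_def intro!: finite_theta_exp_eq\<close>)

  let ?L1 = "{(n, m). A n + C m = int N}"
  let ?L2 = "{(n, m). B n + C m = int N}"
  let ?R = "{(k, j). K k + J j = int N}"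
  let ?ev = "{(x :: int, y :: int). even (x + y)}"
  have fins: "finite ?L1" "finite ?L2" "finite ?R"
    by (rule finite_pair_fibre nonneg fin)+

  \<comment> \<open>In the quadratic form \<open>x\<^sup>2 + 3 y\<^sup>2\<close> underlying all three exponents, the maps below are
    multiplications by sixth roots of unity in \<open>\<int>[(1 + \<surd>-3)/2]\<close>.\<close>
  have "card {(n, t). A n + C (2*t - n) = int N} = card {(k, t). K k + J (2*t - k) = int N}"
    by (rule card_pairs_eq[where f = "\<lambda>n t. t - n" and f' = "\<lambda>n t. t" and g = "\<lambda>k t. t - k" and g' = "\<lambda>k t. t"])
       (auto simp: A C K J algebra_simps)
  then have c1: "card (?L1 \<inter> ?ev) = card (?R \<inter> ?ev)"
    by (simp only: card_even_pairs)
  have "card {(n, t). B n + C (2*t + 1 - n) = int N} = card {(k, t). K k + J (2*t + 1 - k) = int N}"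
    by (rule card_pairs_eq[where f = "\<lambda>n t. -t" and f' = "\<lambda>n t. -n" and g = "\<lambda>k t. -t" and g' = "\<lambda>k t. -k"])
       (auto simp: B C K J algebra_simps)
  then have c2: "card (?L2 - ?ev) = card (?R - ?ev)"
    by (simp only: card_odd_pairs)
  have "card {(n, t). A n + C (2*t + 1 - n) = int N} = card {(u, t). B u + C (2*t - u) = int N}"
    by (rule card_pairs_eq[where f = "\<lambda>n t. -t" and f' = "\<lambda>n t. n - t" and g = "\<lambda>u t. t - u" and g' = "\<lambda>u t. -u"])
       (auto simp: A B C algebra_simps)
  then have c3: "card (?L1 - ?ev) = card (?L2 \<inter> ?ev)"
    by (simp only: card_even_pairs card_odd_pairs)
  have split: "card S = card (S \<inter> ?ev) + card (S - ?ev)" if "finite S" for S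
    using that by (metis card_Int_Diff)

  have "theta 1 (2*h+3) (4*h-3) * theta 1 1 (2*h-1) =
      (index_series (\<lambda>(n, m). A n + C m) (\<lambda>_. 1) :: 'a fps)"
    unfolding theta_def A_def[symmetric] C_def[symmetric]
    by (subst index_series_mult) (simp_all add: nonneg fin case_prod_unfold)
  moreover have "fps_X * theta 1 (2*h-3) (4*h+3) * theta 1 1 (2*h-1) =
      (index_series (\<lambda>(n, m). B n + C m) (\<lambda>_. 1) :: 'a fps)"
    unfolding theta_def C_def[symmetric]
    by (subst fps_X_mult_index_series, simp add: theta_exp_nonneg, fold B_def, subst index_series_mult)
       (simp_all add: nonneg fin case_prod_unfold)
  ultimately have "fps_nth ((theta 1 (2*h+3) (4*h-3) - fps_X * theta 1 (2*h-3) (4*h+3)) *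
      theta 1 1 (2*h-1) :: 'a fps) N = of_nat (card ?L1) - of_nat (card ?L2)"
    by (simp add: left_diff_distrib index_series_def case_prod_unfold)
  also have "\<dots> = of_nat (card (?R \<inter> ?ev)) - of_nat (card (?R - ?ev))"
    using split[OF fins(1)] split[OF fins(2)] c1 c2 c3 by simp
  also have "\<dots> = (\<Sum>x\<in>?R \<inter> ?ev. case x of (k, j) \<Rightarrow> (-1) powi k * (-1) powi j) +
      (\<Sum>x\<in>?R - ?ev. case x of (k, j) \<Rightarrow> (-1) powi k * (-1 :: 'a) powi j)"
  proof -
    have sgn_mult: "(-1) powi k * (-1 :: 'a) powi j = (if even (k + j) then 1 else -1)" for k j :: int
      by (cases "even k"; cases "even j") (simp_all add: powi_minus_one)
    have e1: "(\<Sum>x\<in>?R \<inter> ?ev. case x of (k, j) \<Rightarrow> (-1) powi k * (-1 :: 'a) powi j) = (\<Sum>x\<in>?R \<inter> ?ev. 1)"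
    proof (rule sum.cong[OF refl])
      fix x assume "x \<in> ?R \<inter> ?ev"
      then have "even (fst x + snd x)" by auto
      then show "(case x of (k, j) \<Rightarrow> (-1) powi k * (-1 :: 'a) powi j) = 1"
        by (simp only: case_prod_unfold sgn_mult if_True)
    qed
    have e2: "(\<Sum>x\<in>?R - ?ev. case x of (k, j) \<Rightarrow> (-1) powi k * (-1 :: 'a) powi j) = (\<Sum>x\<in>?R - ?ev. -1)"
    proof (rule sum.cong[OF refl])
      fix x assume "x \<in> ?R - ?ev"
      then have "odd (fst x + snd x)" by auto
      then show "(case x of (k, j) \<Rightarrow> (-1) powi k * (-1 :: 'a) powi j) = -1"
        by (simp only: case_prod_unfold sgn_mult if_False)
    qed
    have "(\<Sum>x\<in>X. 1) = (of_nat (card X) :: 'a)" "(\<Sum>x\<in>X. -1) = - (of_nat (card X) :: 'a)"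
      for X :: "(int \<times> int) set" by simp_all
    then show ?thesis
      unfolding e1 e2 by (simp only: diff_conv_add_uminus)
  qed
  also have "\<dots> = (\<Sum>x\<in>?R. case x of (k, j) \<Rightarrow> (-1) powi k * (-1) powi j)"
    by (rule sum.Int_Diff[OF fins(3), symmetric])
  also have "\<dots> = fps_nth (theta (-1) (2*h) (4*h) * theta (-1) 2 (2*h-2)) N"
    unfolding theta_def K_def[symmetric] J_def[symmetric]
    by (subst index_series_mult) (simp_all add: nonneg fin index_series_def case_prod_unfold)
  finally show "fps_nth ((theta 1 (2*h+3) (4*h-3) - fps_X * theta 1 (2*h-3) (4*h+3)) *
      theta 1 1 (2*h-1)) N = fps_nth (theta (-1) (2*h) (4*h) * theta (-1) 2 (2*h-2) :: 'a fps) N" .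
qed

section \<open>From theta series back to products\<close>

abbreviation euler_prod :: "nat \<Rightarrow> 'a :: comm_ring_1 fps" where
  "euler_prod s \<equiv> fps_part_prod (-1) {p. s dvd p}"

abbreviation residue_prod :: "'a :: comm_ring_1 \<Rightarrow> nat \<Rightarrow> nat \<Rightarrow> 'a fps" where
  "residue_prod c s a \<equiv> fps_part_prod c {p. p mod s = a}"

text \<open>Sort the multiples \<open>2*h*k\<close> by \<open>k\<close> modulo \<open>3\<close>. By
  the triple product, \<open>euler_prod (2*h)\<close> is then itself a theta series.\<close>

lemma euler_prod_split_3:
  assumes "h > 0"
  shows "euler_prod (2*h) = residue_prod (-1) (6*h) (2*h) * residue_prod (-1) (6*h) (4*h) *
           (euler_prod (6*h) :: 'a :: comm_ring_1 fps)"
proof -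
  have "{p. 2*h dvd p} = {p. p mod (6*h) = 2*h} \<union> {p. p mod (6*h) = 4*h} \<union> {p. 6*h dvd p}"
  proof (rule set_eqI)
    fix p
    have "2*h dvd p \<longleftrightarrow> p mod (6*h) = 2*h \<or> p mod (6*h) = 4*h \<or> 6*h dvd p"
    proof
      assume "2*h dvd p"
      then obtain k where k: "p = (2*h) * k" by (elim dvdE)
      have "p mod (6*h) = ((2*h) * k) mod ((2*h) * 3)" by (simp only: k) simp
      also have "\<dots> = (2*h) * (k mod 3)" by (rule mult_mod_right[symmetric])
      finally have p: "p mod (6*h) = (2*h) * (k mod 3)" .
      have "k mod 3 = 0 \<or> k mod 3 = 1 \<or> k mod 3 = 2" by presburger
      then show "p mod (6*h) = 2*h \<or> p mod (6*h) = 4*h \<or> 6*h dvd p"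
      proof (elim disjE)
        assume "k mod 3 = 0"
        with p show ?thesis by (simp only: mult_0_right dvd_eq_mod_eq_0 simp_thms)
      qed (simp_all only: p, simp_all)
    next
      have "(2*h) dvd (2*h) * 3" "(2*h) dvd (2*h) * 2" by (rule dvd_triv_left)+
      then have d: "2*h dvd 6*h" "2*h dvd 4*h" by simp_all
      assume "p mod (6*h) = 2*h \<or> p mod (6*h) = 4*h \<or> 6*h dvd p"
      then have "2*h dvd p mod (6*h)" using d(2) by (elim disjE) simp_all
      then show "2*h dvd p" using d(1) by (simp only: dvd_mod_iff)
    qed
    then show "p \<in> {p. 2*h dvd p} \<longleftrightarrow>
        p \<in> {p. p mod (6*h) = 2*h} \<union> {p. p mod (6*h) = 4*h} \<union> {p. 6*h dvd p}"
      by simp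
  qed
  moreover have "({p. p mod (6*h) = 2*h} \<union> {p. p mod (6*h) = 4*h}) \<inter> {p. 6*h dvd p} \<subseteq> {0}"
    "{p. p mod (6*h) = 2*h} \<inter> {p. p mod (6*h) = 4*h} \<subseteq> {0}"
    using assms by auto
  ultimately show ?thesis by (simp only: fps_part_prod_union)
qed

text \<open>After multiplication by \<open>euler_prod (2*h)\<close>, the triple product turns each
  group of factors into a theta series. One theta factor on the right of the quintuple identity is
  \<open>euler_prod (2*h)\<close> again and cancels, its constant term being
  \<open>1\<close>.\<close>

theorem quintuple_quotient:
  fixes h :: nat
  assumes h: "h \<ge> 2"
  shows "residue_prod 1 (2*h) 1 * residue_prod 1 (2*h) (2*h-1) *
           (residue_prod 1 (6*h) (2*h+3) * residue_prod 1 (6*h) (4*h-3) -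
            fps_X * (residue_prod 1 (6*h) (2*h-3) * residue_prod 1 (6*h) (4*h+3))) *
           euler_prod (6*h) = (theta (-1) 2 (2*h-2) :: 'a :: field fps)"
    (is "?C * (?U - fps_X * ?V) * ?E = ?T")
proof -
  have C: "?C * euler_prod (2*h) = theta 1 1 (2*h-1)"
    using jacobi_triple_product[of 1 "2*h-1" "1 :: 'a"] h by simp
  have U: "?U * ?E = theta 1 (2*h+3) (4*h-3)"
    using jacobi_triple_product[of "2*h+3" "4*h-3" "1 :: 'a"] h by simp
  have V: "?V * ?E = theta 1 (2*h-3) (4*h+3)"
    using jacobi_triple_product[of "2*h-3" "4*h+3" "1 :: 'a"] h by simp
  have W: "euler_prod (2*h) = (theta (-1) (2*h) (4*h) :: 'a fps)"
    using jacobi_triple_product[of "2*h" "4*h" "-1 :: 'a"] h euler_prod_split_3[of h, where ?'a = 'a]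
    by simp
  have "euler_prod (2*h) * (?C * (?U - fps_X * ?V) * ?E) =
      (?U * ?E - fps_X * (?V * ?E)) * (?C * euler_prod (2*h))"
    by (simp only: left_diff_distrib right_diff_distrib mult_ac)
  also have "\<dots> = euler_prod (2*h) * ?T"
    unfolding U V C unfolding W using h by (rule theta_quintuple_product)
  finally have "euler_prod (2*h) * (?C * (?U - fps_X * ?V) * ?E) = euler_prod (2*h) * ?T" .
  moreover have "euler_prod (2*h) \<noteq> (0 :: 'a fps)"
    using fps_part_prod_nth_0[of "-1 :: 'a" "{p. 2*h dvd p}"] by (metis fps_zero_nth zero_neq_one)
  ultimately show ?thesis by simp
qed

section \<open>Coefficients of reciprocal products\<close>

lemma inverse_one_minus_fps_X_power:
  assumes "p > 0"
  shows "inverse (1 - fps_X ^ p) = (Abs_fps (\<lambda>i. if p dvd i then 1 else 0) :: 'a :: field fps)"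
proof (rule fps_inverse_unique, rule fps_ext)
  fix n
  show "fps_nth ((1 - fps_X ^ p) * Abs_fps (\<lambda>i. if p dvd i then 1 else 0 :: 'a)) n = fps_nth 1 n"
    using assms
    by (cases "n < p") (auto simp: left_diff_distrib fps_X_power_mult_nth dvd_minus_self)
qed

definition nonneg_in_power :: "nat \<Rightarrow> real fps \<Rightarrow> bool" where
  "nonneg_in_power d f \<longleftrightarrow> (\<forall>i. fps_nth f i \<ge> 0 \<and> (\<not> d dvd i \<longrightarrow> fps_nth f i = 0))"

lemma nonneg_in_power_mult:
  assumes "nonneg_in_power d f" "nonneg_in_power d g"
  shows "nonneg_in_power d (f * g)"
proof -
  have "fps_nth f i * fps_nth g (n - i) = 0" if "\<not> d dvd n" "i \<le> n" for i n
  proof (cases "d dvd i")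
    case True
    with that have "\<not> d dvd n - i" using dvd_diffD by blast
    then show ?thesis using assms(2) by (simp add: nonneg_in_power_def)
  qed (use assms(1) in \<open>simp add: nonneg_in_power_def\<close>)
  then show ?thesis
    using assms unfolding nonneg_in_power_def fps_mult_nth
    by (auto intro!: sum_nonneg sum.neutral)
qed

text \<open>Each reciprocal factor is a geometric series in \<open>X^p\<close>, the property is
  multiplicative, and every coefficient depends on finitely many factors only.\<close>

lemma nonneg_in_power_inverse_prod:
  assumes "\<And>p. p \<in> P \<Longrightarrow> d dvd p"
  shows "nonneg_in_power d (inverse (fps_part_prod (-1) P))"
proof -
  have fin: "nonneg_in_power d (inverse (\<Prod>p\<in>S. 1 + fps_const (-1) * fps_X ^ p))"
    if "finite S" "\<And>p. p \<in> S \<Longrightarrow> d dvd p \<and> p > 0" for S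
    using that
  proof (induction S rule: finite_induct)
    case (insert p S)
    have "1 + fps_const (-1) * fps_X ^ p = (1 - fps_X ^ p :: real fps)"
      by (simp flip: fps_const_neg)
    moreover have "nonneg_in_power d (inverse (1 - fps_X ^ p))"
      using insert.prems[of p]
      by (auto simp: inverse_one_minus_fps_X_power nonneg_in_power_def intro: dvd_trans)
    ultimately show ?case
      using insert by (simp add: fps_inverse_mult nonneg_in_power_mult)
  qed (simp add: nonneg_in_power_def)
  have "fps_nth (inverse (fps_part_prod (-1) P)) n =
      fps_nth (inverse (\<Prod>p\<in>P \<inter> {1..n}. 1 + fps_const (-1 :: real) * fps_X ^ p)) n" for n
    by (rule agree_upto_nth[OF agree_upto_inverse[OF agree_upto_fps_part_prod]]) auto
  moreover have "nonneg_in_power d (inverse (\<Prod>p\<in>P \<inter> {1..n}. 1 + fps_const (-1) * fps_X ^ p))" for n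
    using assms by (intro fin) auto
  ultimately show ?thesis unfolding nonneg_in_power_def by metis
qed

text \<open>Split off the factor \<open>p = d\<close>. Its reciprocal has coefficient
  \<open>1\<close> at every multiple of \<open>d\<close>; the other reciprocal has constant term
  \<open>1\<close> and nonnegative coefficients. So one term of the convolution is \<open>1\<close>
  and none is negative.\<close>

lemma inverse_prod_nth_ge_1:
  assumes "\<And>p. p \<in> P \<Longrightarrow> d dvd p" "d \<in> P" "d > 0"
  shows "fps_nth (inverse (fps_part_prod (-1) P)) (d * k) \<ge> (1 :: real)"
proof -
  have "fps_part_prod (-1) {d} = (1 - fps_X ^ d :: real fps)"
  proof (rule fps_eqI_agree_upto)
    fix N
    have "agree_upto N (fps_part_prod (-1) {d}) (\<Prod>p\<in>{d}. 1 + fps_const (-1 :: real) * fps_X ^ p)"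
      using assms by (intro agree_upto_fps_part_prod) auto
    then show "agree_upto N (fps_part_prod (-1) {d}) (1 - fps_X ^ d :: real fps)"
      by (simp flip: fps_const_neg)
  qed
  moreover have "P = {d} \<union> (P - {d})" using assms by auto
  moreover have "fps_part_prod (-1 :: real) ({d} \<union> (P - {d})) = fps_part_prod (-1) {d} * fps_part_prod (-1) (P - {d})"
    by (rule fps_part_prod_union) auto
  ultimately have eq: "inverse (fps_part_prod (-1) P) =
      inverse (1 - fps_X ^ d :: real fps) * inverse (fps_part_prod (-1) (P - {d}))"
    by (metis fps_inverse_mult)
  let ?G = "inverse (fps_part_prod (-1 :: real) (P - {d}))"
  let ?t = "\<lambda>i. fps_nth (inverse (1 - fps_X ^ d)) i * fps_nth ?G (d * k - i)"
  have G: "nonneg_in_power d ?G" using assms by (intro nonneg_in_power_inverse_prod) auto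
  have "?t (d * k) \<le> (\<Sum>i=0..d * k. ?t i)"
    by (rule member_le_sum)
       (use G in \<open>auto simp: inverse_one_minus_fps_X_power[OF assms(3)] nonneg_in_power_def\<close>)
  moreover have "?t (d * k) = 1"
    by (simp add: inverse_one_minus_fps_X_power[OF assms(3)])
  ultimately show ?thesis unfolding eq fps_mult_nth by simp
qed

section \<open>The two families of partitions\<close>

lemma theta_minus_one_nth:
  "fps_nth (theta (-1 :: real) a b) i = (\<Sum>j | theta_exp a b j = int i. if even j then 1 else -1)"
  by (simp add: theta_def index_series_def powi_minus_one)

text \<open>For \<open>j \<equiv> 0, 1, 2\<close> the values modulo \<open>3\<close> are
  \<open>0\<close>, \<open>2\<close> and \<open>2*H + 1\<close>; the last is \<open>1\<close> only
  if \<open>3\<close> divides \<open>H\<close>.\<close>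

lemma quadratic_mod_3:
  fixes H j :: int
  assumes "H mod 3 \<noteq> 0"
  shows "(H * (j * (j - 1)) + 2 * j) mod 3 \<noteq> 1"
proof -
  have eq: "(H * (j * (j - 1)) + 2 * j) mod 3 =
      ((H mod 3) * ((j mod 3) * ((j mod 3) - 1)) + 2 * (j mod 3)) mod 3"
    by (intro mod_add_cong mod_mult_cong mod_diff_cong) simp_all
  have "H mod 3 = 1 \<or> H mod 3 = 2" "j mod 3 = 0 \<or> j mod 3 = 1 \<or> j mod 3 = 2"
    using assms by presburger+
  then show ?thesis unfolding eq by (elim disjE) simp_all
qed

lemma quotient_conv_inverse:
  fixes D :: "real fps"
  assumes "D * euler_prod s = T"
  shows "D = T * inverse (euler_prod s)"
proof -
  have "euler_prod s * inverse (euler_prod s :: real fps) = 1"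
    by (rule inverse_mult_eq_1') simp
  then show ?thesis unfolding assms[symmetric] by (simp add: mult.assoc)
qed

text \<open>The reciprocal Euler product has only exponents divisible by \<open>6*h\<close>, so a
  nonzero contribution needs a theta exponent congruent to \<open>n\<close>, hence to
  \<open>1\<close>, modulo \<open>3\<close>.\<close>

lemma quotient_nth_eq_0:
  fixes D :: "real fps"
  assumes D: "D * euler_prod (6*h) = theta (-1) 2 (2*h-2)" and h: "h mod 3 \<noteq> 0" and n: "n mod 3 = 1"
  shows "fps_nth D n = 0"
proof -
  let ?I = "inverse (euler_prod (6*h)) :: real fps"
  have I: "nonneg_in_power (6*h) ?I" by (intro nonneg_in_power_inverse_prod) auto
  have "fps_nth (theta (-1) 2 (2*h-2)) i * fps_nth ?I (n - i) = 0" if i: "i \<le> n" for i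
  proof (rule ccontr)
    assume "fps_nth (theta (-1) 2 (2*h-2)) i * fps_nth ?I (n - i) \<noteq> 0"
    then have "fps_nth (theta (-1 :: real) 2 (2*h-2)) i \<noteq> 0" "6*h dvd n - i"
      using I by (auto simp: nonneg_in_power_def)
    have "{j. theta_exp 2 (2*h-2) j = int i} \<noteq> {}"
    proof
      assume "{j. theta_exp 2 (2*h-2) j = int i} = {}"
      then show False
        using \<open>fps_nth (theta (-1 :: real) 2 (2*h-2)) i \<noteq> 0\<close> by (simp only: theta_minus_one_nth sum.empty)
    qed
    then obtain j where "theta_exp 2 (2*h-2) j = int i" by auto
    moreover have "3 dvd n - i"
      using \<open>6*h dvd n - i\<close> by (rule dvd_trans[rotated]) simp
    \<comment> \<open>\<open>h mod 3 \<noteq> 0\<close> makes \<open>h\<close> positive, so the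
      natural subtraction is exact.\<close>
    moreover have "2 + (2*h-2) = 2*h" using h by (cases h) auto
    ultimately have "int h * (j * (j - 1)) + 2 * j = int i" by (simp add: theta_exp_eq)
    moreover have "i mod 3 = 1" using \<open>3 dvd n - i\<close> n i by presburger
    then have "int i mod 3 = 1" by presburger
    moreover have "int h mod 3 \<noteq> 0" using h by presburger
    ultimately show False using quadratic_mod_3[of "int h" j] by simp
  qed
  then show ?thesis
    unfolding quotient_conv_inverse[OF D] fps_mult_nth by (intro sum.neutral) auto
qed

text \<open>Contributing theta exponents \<open>4*j*(j-1) + 2*j\<close> are \<open>2\<close> modulo
  \<open>4\<close>, which forces odd \<open>j\<close> and sign \<open>-1\<close>. No term is
  positive, and \<open>i = 2\<close>, coming from \<open>j = 1\<close>, gives a negative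
  one.\<close>

lemma quotient_24_nth_neg:
  fixes D :: "real fps"
  assumes D: "D * euler_prod 24 = theta (-1) 2 6"
  shows "fps_nth D (24 * k + 2) < 0"
proof -
  let ?I = "inverse (euler_prod 24) :: real fps"
  let ?T = "theta (-1) 2 6 :: real fps"
  let ?n = "24 * k + 2"
  let ?t = "\<lambda>i. fps_nth ?T i * fps_nth ?I (?n - i)"
  have I: "nonneg_in_power 24 ?I" by (intro nonneg_in_power_inverse_prod) auto
  have T: "fps_nth ?T i = - real (card {j. theta_exp 2 6 j = int i})" if "i mod 4 = 2" for i
  proof -
    have "odd j" if j: "theta_exp 2 6 j = int i" for j
    proof
      assume "even j"
      then obtain m where m: "j = 2 * m" by (elim evenE)
      have "int i = 4 * (j * (j - 1)) + 2 * j" using j by (simp add: theta_exp_eq[of 2 6 4])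
      then have "int i = 4 * (j * (j - 1) + m)" by (simp add: m)
      then have "int i mod 4 = 0" by simp
      with \<open>i mod 4 = 2\<close> show False by presburger
    qed
    then have "fps_nth ?T i = (\<Sum>j | theta_exp 2 6 j = int i. -1)"
      unfolding theta_minus_one_nth by (intro sum.cong) auto
    then show ?thesis by simp
  qed
  have "?t i \<le> 0" if "i \<le> ?n" for i
  proof (cases "24 dvd ?n - i")
    case True
    then obtain m where "?n - i = 24 * m" by (elim dvdE)
    with that have "i + 4 * (6 * m) = 4 * (6 * k) + 2" by simp
    then have "(i + 4 * (6 * m)) mod 4 = (4 * (6 * k) + 2) mod 4" by (simp only:)
    then have "i mod 4 = 2" by (simp only: mod_mult_self2 mod_mult_self4) simp
    then show ?thesis using T[of i] I by (simp add: nonneg_in_power_def mult_nonpos_nonneg)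
  qed (use I in \<open>simp add: nonneg_in_power_def\<close>)
  then have "(\<Sum>i=0..?n. - ?t i) \<ge> - ?t 2"
    by (intro member_le_sum) auto
  then have "fps_nth D ?n \<le> ?t 2"
    unfolding quotient_conv_inverse[OF D] fps_mult_nth by (simp add: sum_negf)
  also have "?t 2 < 0"
  proof (rule mult_neg_pos)
    have "1 \<in> {j. theta_exp 2 6 j = int 2}" by (simp add: theta_exp_eq[of 2 6 4])
    then have "card {j. theta_exp 2 6 j = int 2} > 0"
      using finite_theta_exp_eq[of 2 6 "int 2"] by (auto simp: card_gt_0_iff)
    then show "fps_nth ?T 2 < 0" using T[of 2] by simp
    have "fps_nth ?I (24 * k) \<ge> 1" by (rule inverse_prod_nth_ge_1) auto
    then show "fps_nth ?I (?n - 2) > 0" by simp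
  qed
  finally show ?thesis .
qed

text \<open>If \<open>15\<close> divides the exponent \<open>5*j^2 - 3*j\<close>, then
  \<open>3\<close> and \<open>5\<close> both divide \<open>j\<close>. Putting
  \<open>j = 15*m\<close> gives \<open>1125*m^2 - 45*m\<close>, the exponent for \<open>1080\<close>
  and \<open>1170\<close>; signs agree because \<open>15\<close> is odd.\<close>

lemma theta_30_nth:
  assumes "30 dvd i"
  shows "fps_nth (theta (-1 :: real) 2 8) i = fps_nth (theta (-1) 1080 1170) i"
proof -
  have e1: "theta_exp 2 8 j = 5 * (j * j) - 3 * j" for j
    by (simp add: theta_exp_eq[of 2 8 5] algebra_simps)
  have e2: "theta_exp 1080 1170 m = theta_exp 2 8 (15 * m)" for m
    by (simp add: theta_exp_eq[of 1080 1170 1125] e1 algebra_simps)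
  have dvd: "15 dvd j" if "theta_exp 2 8 j = int i" for j
  proof -
    have "30 dvd 5 * (j * j) - 3 * j"
      using assms that unfolding e1 by (metis int_dvd_int_iff of_nat_numeral)
    then have *: "15 dvd 5 * (j * j) - 3 * j"
      by (rule dvd_trans[rotated]) simp
    then obtain q where q: "5 * (j * j) - 3 * j = 15 * q" by (elim dvdE)
    then have "j * j = 3 * (2 * (j * j) - j - 5 * q)" by simp
    then have "3 dvd j * j" by (rule dvdI)
    then have "3 dvd j" by (simp add: prime_dvd_mult_iff)
    then obtain a where a: "j = 3 * a" by (elim dvdE)
    have "j = 5 * (2 * (j * j) - 6 * q - j)" using q by simp
    \<comment> \<open>The combination \<open>j = 6*j - 5*j = 30*(j/5) - 15*(j/3)\<close> merges the
      two divisibilities.\<close>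
    then have "j = 15 * (2 * (2 * (j * j) - 6 * q - j) - a)" using a by simp
    then show ?thesis by (rule dvdI)
  qed
  have "(\<Sum>m | theta_exp 1080 1170 m = int i. if even m then 1 else -1 :: real) =
      (\<Sum>j | theta_exp 2 8 j = int i. if even j then 1 else -1)"
    by (rule sum.reindex_bij_witness[of _ "\<lambda>j. j div 15" "\<lambda>m. 15 * m"])
       (use dvd in \<open>auto simp: e2\<close>)
  then show ?thesis by (simp add: theta_minus_one_nth)
qed

text \<open>Only theta exponents divisible by \<open>30\<close> contribute, so the theta series may
  be replaced by \<open>?T\<close>. Since \<open>1080\<close>, \<open>1170\<close> and their sum
  \<open>2250\<close> are multiples of \<open>30\<close>, the triple product shows that
  \<open>?T\<close> divides \<open>euler_prod 30\<close>, leaving a reciprocal product.\<close>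

lemma quotient_30_nth_pos:
  fixes D :: "real fps"
  assumes D: "D * euler_prod 30 = theta (-1) 2 8"
  shows "fps_nth D (30 * k) > 0"
proof -
  let ?I = "inverse (euler_prod 30) :: real fps"
  let ?T = "theta (-1) 1080 1170 :: real fps"
  \<comment> \<open>The multiples of \<open>30\<close> left after removing the factors of
    \<open>?T\<close>; \<open>30\<close> itself remains, which yields the lower bound at every
    \<open>30 * k\<close>.\<close>
  define P where "P = {p :: nat. 30 dvd p \<and> p mod 2250 \<noteq> 0 \<and> p mod 2250 \<noteq> 1080 \<and> p mod 2250 \<noteq> 1170}"
  have I: "nonneg_in_power 30 ?I" by (intro nonneg_in_power_inverse_prod) auto
  have "fps_nth D (30 * k) = fps_nth (?T * ?I) (30 * k)"
    unfolding quotient_conv_inverse[OF D] fps_mult_nth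
  proof (rule sum.cong[OF refl])
    fix i assume i: "i \<in> {0..30 * k}"
    show "fps_nth (theta (-1) 2 8) i * fps_nth ?I (30 * k - i) = fps_nth ?T i * fps_nth ?I (30 * k - i)"
    proof (cases "30 dvd i")
      case False
      with i have "\<not> 30 dvd 30 * k - i" using dvd_diffD1[of 30 "30 * k" i] by auto
      then show ?thesis using I by (simp add: nonneg_in_power_def)
    qed (simp add: theta_30_nth)
  qed
  also have "?T * ?I = inverse (fps_part_prod (-1) P)"
  proof -
    let ?R1 = "{p :: nat. p mod 2250 = 1080}" and ?R2 = "{p :: nat. p mod 2250 = 1170}"
    let ?R0 = "{p :: nat. 2250 dvd p}"
    have sets: "{p. 30 dvd p} = ((?R1 \<union> ?R2) \<union> ?R0) \<union> P"
    proof (rule set_eqI)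
      fix p :: nat
      have "30 dvd p mod 2250 \<longleftrightarrow> 30 dvd p" by (rule dvd_mod_iff) simp
      then have "30 dvd p" if "p mod 2250 = 0 \<or> p mod 2250 = 1080 \<or> p mod 2250 = 1170"
        using that by auto
      then show "p \<in> {p. 30 dvd p} \<longleftrightarrow> p \<in> ((?R1 \<union> ?R2) \<union> ?R0) \<union> P"
        unfolding P_def dvd_eq_mod_eq_0[of 2250] by auto
    qed
    have disj: "?R1 \<inter> ?R2 \<subseteq> {0}" "(?R1 \<union> ?R2) \<inter> ?R0 \<subseteq> {0}" "((?R1 \<union> ?R2) \<union> ?R0) \<inter> P \<subseteq> {0}"
      by (auto simp: P_def)
    have "fps_part_prod (-1 :: real) (((?R1 \<union> ?R2) \<union> ?R0) \<union> P) =
        fps_part_prod (-1) ?R1 * fps_part_prod (-1) ?R2 * fps_part_prod (-1) ?R0 * fps_part_prod (-1) P"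
      using disj by (simp only: fps_part_prod_union)
    then have E: "euler_prod 30 = ?T * fps_part_prod (-1) P"
      using jacobi_triple_product[of 1080 1170 "-1 :: real"] unfolding sets by simp
    have "?T * ?I = (?T * inverse ?T) * inverse (fps_part_prod (-1) P)"
      unfolding E by (simp add: fps_inverse_mult mult_ac)
    moreover have "fps_nth ?T 0 = 1"
      using jacobi_triple_product[of 1080 1170 "-1 :: real", symmetric] by simp
    then have "?T * inverse ?T = 1" by (intro inverse_mult_eq_1') simp
    ultimately show ?thesis by simp
  qed
  also have "fps_nth (inverse (fps_part_prod (-1 :: real) P)) (30 * k) \<ge> 1"
    by (rule inverse_prod_nth_ge_1) (auto simp: P_def)
  finally show ?thesis by simp
qed

section \<open>Generating functions of the four partition counts\<close>

lemma part_prod_diff_nth: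
  assumes "n > 0"
  shows "fps_nth (fps_part_prod 1 {p. cong_pm m R p} - fps_X * fps_part_prod 1 {p. cong_pm m R' p} :: real fps) n =
    real (card (distinct_partitions m R n)) - real (card (distinct_partitions m R' (n - 1)))"
  using assms by (simp add: card_distinct_partitions_eq_nth)

lemma cong_pm_insert:
  "cong_pm m (insert r R) p \<longleftrightarrow> int p mod int m = r mod int m \<or> int p mod int m = (- r) mod int m \<or> cong_pm m R p"
  by (auto simp: cong_pm_def cong_def)

lemma cong_pm_empty: "\<not> cong_pm m {} p"
  by (simp add: cong_pm_def)

lemma int_mod_eq_iff:
  "int p mod numeral m = 1 \<longleftrightarrow> p mod numeral m = 1"
  "int p mod numeral m = numeral r \<longleftrightarrow> p mod numeral m = numeral r"
  by (metis of_nat_1 of_nat_eq_iff of_nat_mod of_nat_numeral)+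

lemma part_prod_residues:
  assumes "{p. cong_pm m R p} = {p. p mod s = a} \<union> {p. p mod s = b} \<union> ({p. p mod t = c} \<union> {p. p mod t = d})"
    and "{p. p mod s = a} \<inter> {p. p mod s = b} = {}" "{p. p mod t = c} \<inter> {p. p mod t = d} = {}"
    and "({p. p mod s = a} \<union> {p. p mod s = b}) \<inter> ({p. p mod t = c} \<union> {p. p mod t = d}) = {}"
  shows "fps_part_prod e {p. cong_pm m R p} =
    residue_prod e s a * residue_prod e s b * (residue_prod e t c * residue_prod e t d)"
  using assms by (simp add: fps_part_prod_union)

text \<open>The residues \<open>\<plusminus>1, \<plusminus>7, \<plusminus>9\<close> modulo
  \<open>24\<close> are exactly \<open>\<plusminus>1\<close> modulo \<open>8\<close>. The remaining
  ones are \<open>2*h + 3, 4*h - 3\<close> and \<open>2*h - 3, 4*h + 3\<close> for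
  \<open>h = 4\<close>.\<close>

lemma part_prod_24:
  "fps_part_prod e {p. cong_pm 24 {1, 7, 9, 11} p} =
     residue_prod e 8 1 * residue_prod e 8 7 * (residue_prod e 24 11 * residue_prod e 24 13)"
  "fps_part_prod e {p. cong_pm 24 {1, 5, 7, 9} p} =
     residue_prod e 8 1 * residue_prod e 8 7 * (residue_prod e 24 5 * residue_prod e 24 19)"
proof -
  have r: "p mod 8 = 1 \<longleftrightarrow> p mod 24 = 1 \<or> p mod 24 = 9 \<or> p mod 24 = 17"
    "p mod 8 = 7 \<longleftrightarrow> p mod 24 = 7 \<or> p mod 24 = 15 \<or> p mod 24 = 23" for p :: nat
  proof -
    have "\<forall>q\<in>set [0..<24]. (q mod 8 = 1 \<longleftrightarrow> q = 1 \<or> q = 9 \<or> q = 17) \<and>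
        (q mod 8 = 7 \<longleftrightarrow> q = 7 \<or> q = 15 \<or> q = 23)"
      by code_simp
    moreover have "p mod 24 \<in> set [0..<24]" by simp
    moreover have "p mod 24 mod 8 = p mod 8" by (rule mod_mod_cancel) simp
    ultimately show "p mod 8 = 1 \<longleftrightarrow> p mod 24 = 1 \<or> p mod 24 = 9 \<or> p mod 24 = 17"
      "p mod 8 = 7 \<longleftrightarrow> p mod 24 = 7 \<or> p mod 24 = 15 \<or> p mod 24 = 23"
      by metis+
  qed
  show "fps_part_prod e {p. cong_pm 24 {1, 7, 9, 11} p} =
     residue_prod e 8 1 * residue_prod e 8 7 * (residue_prod e 24 11 * residue_prod e 24 13)"
    by (rule part_prod_residues) (auto simp: cong_pm_insert cong_pm_empty int_mod_eq_iff r simp del: One_nat_def)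
  show "fps_part_prod e {p. cong_pm 24 {1, 5, 7, 9} p} =
     residue_prod e 8 1 * residue_prod e 8 7 * (residue_prod e 24 5 * residue_prod e 24 19)"
    by (rule part_prod_residues) (auto simp: cong_pm_insert cong_pm_empty int_mod_eq_iff r simp del: One_nat_def)
qed

text \<open>The same with \<open>h = 5\<close>:
  \<open>\<plusminus>1, \<plusminus>9, \<plusminus>11\<close> modulo \<open>30\<close> are exactly
  \<open>\<plusminus>1\<close> modulo \<open>10\<close>.\<close>

lemma part_prod_30:
  "fps_part_prod e {p. cong_pm 30 {1, 9, 11, 13} p} =
     residue_prod e 10 1 * residue_prod e 10 9 * (residue_prod e 30 13 * residue_prod e 30 17)"
  "fps_part_prod e {p. cong_pm 30 {1, 7, 9, 11} p} =
     residue_prod e 10 1 * residue_prod e 10 9 * (residue_prod e 30 7 * residue_prod e 30 23)"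
proof -
  have r: "p mod 10 = 1 \<longleftrightarrow> p mod 30 = 1 \<or> p mod 30 = 11 \<or> p mod 30 = 21"
    "p mod 10 = 9 \<longleftrightarrow> p mod 30 = 9 \<or> p mod 30 = 19 \<or> p mod 30 = 29" for p :: nat
  proof -
    have "\<forall>q\<in>set [0..<30]. (q mod 10 = 1 \<longleftrightarrow> q = 1 \<or> q = 11 \<or> q = 21) \<and>
        (q mod 10 = 9 \<longleftrightarrow> q = 9 \<or> q = 19 \<or> q = 29)"
      by code_simp
    moreover have "p mod 30 \<in> set [0..<30]" by simp
    moreover have "p mod 30 mod 10 = p mod 10" by (rule mod_mod_cancel) simp
    ultimately show "p mod 10 = 1 \<longleftrightarrow> p mod 30 = 1 \<or> p mod 30 = 11 \<or> p mod 30 = 21"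
      "p mod 10 = 9 \<longleftrightarrow> p mod 30 = 9 \<or> p mod 30 = 19 \<or> p mod 30 = 29"
      by metis+
  qed
  show "fps_part_prod e {p. cong_pm 30 {1, 9, 11, 13} p} =
     residue_prod e 10 1 * residue_prod e 10 9 * (residue_prod e 30 13 * residue_prod e 30 17)"
    by (rule part_prod_residues) (auto simp: cong_pm_insert cong_pm_empty int_mod_eq_iff r simp del: One_nat_def)
  show "fps_part_prod e {p. cong_pm 30 {1, 7, 9, 11} p} =
     residue_prod e 10 1 * residue_prod e 10 9 * (residue_prod e 30 7 * residue_prod e 30 23)"
    by (rule part_prod_residues) (auto simp: cong_pm_insert cong_pm_empty int_mod_eq_iff r simp del: One_nat_def)
qed

text \<open>Its coefficient at \<open>n > 0\<close> is \<open>Q11 n - Q5 (n - 1)\<close>.\<close>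

definition partition_diff_24 :: "real fps" where
  "partition_diff_24 = fps_part_prod 1 {p. cong_pm 24 {1, 7, 9, 11} p} -
           fps_X * fps_part_prod 1 {p. cong_pm 24 {1, 5, 7, 9} p}"

definition partition_diff_30 :: "real fps" where
  "partition_diff_30 = fps_part_prod 1 {p. cong_pm 30 {1, 9, 11, 13} p} -
           fps_X * fps_part_prod 1 {p. cong_pm 30 {1, 7, 9, 11} p}"

lemma partition_diff_24_nth_eq_0_iff: "n > 0 \<Longrightarrow> fps_nth partition_diff_24 n = 0 \<longleftrightarrow> Q5 (n - 1) = Q11 n"
  unfolding partition_diff_24_def Q11_def Q5_def by (subst part_prod_diff_nth) auto

lemma partition_diff_30_nth_eq_0_iff: "n > 0 \<Longrightarrow> fps_nth partition_diff_30 n = 0 \<longleftrightarrow> frakQ7 (n - 1) = frakQ13 n"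
  unfolding partition_diff_30_def frakQ13_def frakQ7_def by (subst part_prod_diff_nth) auto

lemma partition_diff_24_mult_euler_prod: "partition_diff_24 * euler_prod 24 = theta (-1) 2 6"
proof -
  have "partition_diff_24 = residue_prod 1 8 1 * residue_prod 1 8 7 *
      (residue_prod 1 24 11 * residue_prod 1 24 13 -
       fps_X * (residue_prod 1 24 5 * residue_prod 1 24 19))"
    unfolding partition_diff_24_def part_prod_24 by (simp only: right_diff_distrib mult_ac)
  then show ?thesis
    using quintuple_quotient[of 4, where ?'a = real] by simp
qed

lemma partition_diff_30_mult_euler_prod: "partition_diff_30 * euler_prod 30 = theta (-1) 2 8"
proof -
  have "partition_diff_30 = residue_prod 1 10 1 * residue_prod 1 10 9 *
      (residue_prod 1 30 13 * residue_prod 1 30 17 -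
       fps_X * (residue_prod 1 30 7 * residue_prod 1 30 23))"
    unfolding partition_diff_30_def part_prod_30 by (simp only: right_diff_distrib mult_ac)
  then show ?thesis
    using quintuple_quotient[of 5, where ?'a = real] by simp
qed

theorem theorem1p1:
  shows "(\<forall>n::nat. 0 < n \<and> [n = 4] (mod 6) \<longrightarrow>
            Q5 (n - 1) = Q11 n \<and> frakQ7 (n - 1) = frakQ13 n)
       \<and> infinite {n::nat. 0 < n \<and> ([n = 0] (mod 6) \<or> [n = 2] (mod 6)) \<and> Q5 (n - 1) \<noteq> Q11 n}
       \<and> infinite {m::nat. 0 < m \<and> ([m = 0] (mod 6) \<or> [m = 2] (mod 6)) \<and> frakQ7 (m - 1) \<noteq> frakQ13 m}"
proof (intro conjI allI impI)
  fix n :: nat assume n: "0 < n \<and> [n = 4] (mod 6)"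
  \<comment> \<open>The class \<open>1\<close> modulo \<open>3\<close> is the one that the theta
    exponents avoid for \<open>h = 4\<close> and \<open>h = 5\<close>.\<close>
  then have pos: "0 < n" and mod: "n mod 3 = 1" unfolding cong_def by presburger+
  have "fps_nth partition_diff_24 n = 0"
    by (rule quotient_nth_eq_0[where h = 4]) (use partition_diff_24_mult_euler_prod mod in simp_all)
  then show "Q5 (n - 1) = Q11 n"
    unfolding partition_diff_24_nth_eq_0_iff[OF pos] .
  have "fps_nth partition_diff_30 n = 0"
    by (rule quotient_nth_eq_0[where h = 5]) (use partition_diff_30_mult_euler_prod mod in simp_all)
  then show "frakQ7 (n - 1) = frakQ13 n"
    unfolding partition_diff_30_nth_eq_0_iff[OF pos] .
next
  let ?A = "{n::nat. 0 < n \<and> ([n = 0] (mod 6) \<or> [n = 2] (mod 6)) \<and> Q5 (n - 1) \<noteq> Q11 n}"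
  \<comment> \<open>These indices are \<open>2\<close> modulo \<open>6\<close>, and the difference
    is negative there.\<close>
  have "24 * k + 2 \<in> ?A" for k
  proof -
    have pos: "0 < 24 * k + 2" by simp
    have "Q5 (24 * k + 2 - 1) \<noteq> Q11 (24 * k + 2)"
      using quotient_24_nth_neg[OF partition_diff_24_mult_euler_prod, of k]
      unfolding partition_diff_24_nth_eq_0_iff[OF pos, symmetric] by (rule less_imp_neq)
    moreover have "[24 * k + 2 = 2] (mod 6)" unfolding cong_def by presburger
    ultimately show ?thesis using pos by (intro CollectI conjI disjI2)
  qed
  then have "range (\<lambda>k. 24 * k + 2) \<subseteq> ?A" by (rule image_subsetI)
  moreover have "infinite (range (\<lambda>k::nat. 24 * k + 2))"
    by (subst finite_image_iff) (auto simp: inj_def)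
  ultimately show "infinite ?A" by (rule infinite_super)
next
  let ?A = "{m::nat. 0 < m \<and> ([m = 0] (mod 6) \<or> [m = 2] (mod 6)) \<and> frakQ7 (m - 1) \<noteq> frakQ13 m}"
  \<comment> \<open>These indices are \<open>0\<close> modulo \<open>6\<close>; \<open>Suc\<close>
    excludes \<open>0\<close>, where the coefficient is not a difference of partition
    counts.\<close>
  have "30 * Suc k \<in> ?A" for k
  proof -
    have pos: "0 < 30 * Suc k" by simp
    have "frakQ7 (30 * Suc k - 1) \<noteq> frakQ13 (30 * Suc k)"
      using quotient_30_nth_pos[OF partition_diff_30_mult_euler_prod, of "Suc k"]
      unfolding partition_diff_30_nth_eq_0_iff[OF pos, symmetric] by (rule less_imp_neq[THEN not_sym])
    moreover have "[30 * Suc k = 0] (mod 6)" unfolding cong_def by presburger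
    ultimately show ?thesis using pos by (intro CollectI conjI disjI1)
  qed
  then have "range (\<lambda>k. 30 * Suc k) \<subseteq> ?A" by (rule image_subsetI)
  moreover have "infinite (range (\<lambda>k::nat. 30 * Suc k))"
    by (subst finite_image_iff) (auto simp: inj_def)
  ultimately show "infinite ?A" by (rule infinite_super)
qed

end
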